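(* Consider the problem $\min_{\mathbf{x}\in X}F(\mathbf{x})$ with $F=\sum_{i=1}^n f_i$, $X=\bigcap_{i=1}^n X_i$, the strongly connected directed graph $\mathcal{G}$ and the row stochastic weight matrix $W$ satisfying the standing assumptions listed in the context. Suppose that the step size sequence $\{\alpha(t)\}_{t\ge 0}$ is positive and nonincreasing with $\sum_{t=0}^\infty \alpha(t)=\infty$ and $\sum_{t=0}^\infty\alpha^2(t)<\infty$. Then, for any sequences $\{\mathbf{x}_i(t)\}_{t\ge0}$, $i\in\mathcal{V}$, generated by Algorithm 1, and likewise for any generated by Algorithm 2, there exists $\mathbf{x}^*\in X^*$ such that $\lim_{t\to\infty}\mathbf{x}_i(t)=\mathbf{x}^*$ for all $i\in\mathcal{V}$.
   Context: Network. $\mathcal{V}=\{1,\dots,n\}$; $\mathcal{G}=(\mathcal{V},\mathcal{E})$ is a fixed, strongly connected directed graph. The weight matrix $W=[w_{ij}]\in\mathbb{R}^{n\times n}$ is nonnegative and row stochastic ($W\mathbf{1}=\mathbf{1}$), with $w_{ii}>0$ for all $i$, $w_{ij}>0$ for $(i,j)\in\mathcal{E}$, and $w_{ij}=0$ for all other pairs $i\ne j$. Problem. For each $i\in\mathcal{V}$, $f_i:\mathbb{R}^m\to\mathbb{R}$ is convex and $X_i\subseteq\mathbb{R}^m$ is closed and convex; $X=\bigcap_{i}X_i\ne\varnothing$; $F=\sum_i f_i$; $F^*=\min_X F$ and $X^*$ is the set of minimizers of $F$ over $X$, assumed nonempty. Let $U=\mathrm{conv}(\bigcup_i X_i)$ be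 the convex hull. $\mathrm{dist}$ is Euclidean distance, $\|\cdot\|$ the Euclidean norm, $P_Y$ the Euclidean projection onto a nonempty closed convex set $Y$, $\partial f$ the convex subdifferential. - Regularity: $\{X_i\}$ is regular with respect to $U$, i.e. there is $R\ge1$ with $\mathrm{dist}(\mathbf{x},X)\le R\max_{i\in\mathcal{V}}\mathrm{dist}(\mathbf{x},X_i)$ for all $\mathbf{x}\in U$. - Bounded subgradients: there is $L\in(0,\infty)$ with $\|\mathbf{g}\|\le L$ for all $\mathbf{g}\in\partial f_i(\mathbf{x})$, all $\mathbf{x}\in U$, all $i\in\mathcal{V}$. Algorithm 1. Each agent $i$ chooses an initial $\mathbf{x}_i(0)\in\mathbb{R}^m$ and sets $\mathbf{z}_i(0)=\mathbf{e}_i\in\mathbb{R}^n$ ($i$-th standard basis vector). For $t\ge0$, $$\mathbf{x}_i(t+1)=P_{X_i}\Big(\sum_{j}w_{ij}\mathbf{x}_j(t)-\alpha(t)\frac{\mathbf{g}_i(t)}{z_{ii}(t)}\Big),\qquad \mathbf{z}_i(t+1)=\sum_j w_{ij}\mathbf{z}_j(t),$$ where $\mathbf{g}_i(t)\in\partial f_i\big(\sum_j w_{ij}\mathbf{x}_j(t)\big)$ is an arbitrary choice and $z_{ii}(t)$ is the $i$-th entry of $\mathbf{z}_i(t)$. Algorithm 2. Same initialization and same $\mathbf{z}$-update, but $$\mathbf{x}_i(t+1)=P_{X_i}\Big(\sum_{j}w_{ij}\big(\mathbf{x}_j(t)-\alpha(t)\tfrac{\mathbf{g}_j(t)}{z_{jj}(t)}\big)\Big),\qquad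 \mathbf{g}_i(t)\in\partial f_i(\mathbf{x}_i(t)).$$ *)

theory Defs
  imports
    "HOL-Analysis.Analysis"
    "Graph_Theory.Pair_Digraph"
    "Graph_Theory.Digraph_Component"
begin

text \<open>The agents are the elements of a finite type \<open>'n\<close>, so a matrix in
  \<open>real^'n^'n\<close> has its rows and columns indexed by agents.\<close>

text \<open>The edge relation may or may not contain self-loops; the diagonal of the
  weight matrix is positive in either case.\<close>

definition weight_matrix :: "('n::finite \<times> 'n) set \<Rightarrow> real^'n^'n \<Rightarrow> bool" where
  "weight_matrix E W \<longleftrightarrow>
     (\<forall>i j. 0 \<le> W $ i $ j) \<and> W *v 1 = 1 \<and>
     (\<forall>i. 0 < W $ i $ i) \<and>
     (\<forall>i j. (i, j) \<in> E \<longrightarrow> 0 < W $ i $ j) \<and>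
     (\<forall>i j. i \<noteq> j \<and> (i, j) \<notin> E \<longrightarrow> W $ i $ j = 0)"

definition subdifferential :: "('a::real_inner \<Rightarrow> real) \<Rightarrow> 'a \<Rightarrow> 'a set" where
  "subdifferential f x = {g. \<forall>y. f y \<ge> f x + g \<bullet> (y - x)}"

text \<open>\<^const>\<open>infdist\<close> to the empty set is 0 by convention; below, the
  intersection of the sets is always assumed nonempty.\<close>

definition set_regular :: "('n::finite \<Rightarrow> 'a::metric_space set) \<Rightarrow> 'a set \<Rightarrow> bool" where
  "set_regular X U \<longleftrightarrow>
     (\<exists>R\<ge>1. \<forall>x\<in>U. infdist x (\<Inter>i. X i) \<le> R * (MAX i. infdist x (X i)))"

definition bounded_subgradients ::
    "('n \<Rightarrow> 'a::real_inner \<Rightarrow> real) \<Rightarrow> 'a set \<Rightarrow> bool" where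
  "bounded_subgradients f U \<longleftrightarrow>
     (\<exists>L>0. \<forall>i. \<forall>x\<in>U. \<forall>g\<in>subdifferential (f i) x. norm g \<le> L)"

definition optimal_set ::
    "('n::finite \<Rightarrow> 'a \<Rightarrow> real) \<Rightarrow> ('n \<Rightarrow> 'a set) \<Rightarrow> 'a set" where
  "optimal_set f X = {x. is_arg_min (\<lambda>x. \<Sum>i\<in>UNIV. f i x) (\<lambda>x. x \<in> (\<Inter>i. X i)) x}"

primrec z_seq :: "real^'n^'n \<Rightarrow> nat \<Rightarrow> 'n::finite \<Rightarrow> real^'n" where
  "z_seq W 0 = (\<lambda>i. axis i 1)"
| "z_seq W (Suc t) = (\<lambda>i. \<Sum>j\<in>UNIV. (W $ i $ j) *\<^sub>R z_seq W t j)"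

text \<open>In both algorithms \<open>x t i\<close> is the iterate of agent \<open>i\<close> at time \<open>t\<close>; the initial
  points \<open>x 0 i\<close> and the choice \<open>g\<close> of subgradients are arbitrary.\<close>

definition generated_by_alg1 ::
    "real^'n^'n \<Rightarrow> ('n::finite \<Rightarrow> real^'m \<Rightarrow> real) \<Rightarrow> ('n \<Rightarrow> (real^'m::finite) set) \<Rightarrow>
     (nat \<Rightarrow> real) \<Rightarrow> (nat \<Rightarrow> 'n \<Rightarrow> real^'m) \<Rightarrow> bool" where
  "generated_by_alg1 W f X \<alpha> x \<longleftrightarrow>
     (\<exists>g. \<forall>t i.
        g t i \<in> subdifferential (f i) (\<Sum>j\<in>UNIV. (W $ i $ j) *\<^sub>R x t j) \<and>
        x (Suc t) i = closest_point (X i)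
          ((\<Sum>j\<in>UNIV. (W $ i $ j) *\<^sub>R x t j) - (\<alpha> t / z_seq W t i $ i) *\<^sub>R g t i))"

definition generated_by_alg2 ::
    "real^'n^'n \<Rightarrow> ('n::finite \<Rightarrow> real^'m \<Rightarrow> real) \<Rightarrow> ('n \<Rightarrow> (real^'m::finite) set) \<Rightarrow>
     (nat \<Rightarrow> real) \<Rightarrow> (nat \<Rightarrow> 'n \<Rightarrow> real^'m) \<Rightarrow> bool" where
  "generated_by_alg2 W f X \<alpha> x \<longleftrightarrow>
     (\<exists>g. \<forall>t i.
        g t i \<in> subdifferential (f i) (x t i) \<and>
        x (Suc t) i = closest_point (X i)
          (\<Sum>j\<in>UNIV. (W $ i $ j) *\<^sub>R (x t j - (\<alpha> t / z_seq W t j $ j) *\<^sub>R g t j)))"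

end

theory Submission
  imports Defs
begin

text \<open>Let \<open>p\<close> be the positive stationary vector of \<open>W\<close> and \<open>V c = (\<Sum>i. p i * (norm (x i - c))\<^sup>2)\<close>.
  Averaging with \<open>W\<close> decreases \<open>V c\<close> by a weighted variance that, by strong connectivity,
  dominates the square of the disagreement \<open>spread x\<close>. The same contraction applied to the
  \<open>z\<close>-iteration gives \<open>z i $ i \<longlonglongrightarrow> p i\<close> geometrically, so that scaling the steps by
  \<open>1 / z i $ i\<close> undoes the weights \<open>p i\<close> up to a summable error. From time 1 on, \<open>x i \<in> X i\<close>,
  hence by regularity the distance to the feasible set is bounded by a multiple of the spread, and
  the first-order terms \<open>\<alpha> * spread x\<close> are absorbed by the quadratic decrease at the cost of
  \<open>O(\<alpha>\<^sup>2)\<close>. The Robbins--Siegmund argument then yields convergence of \<open>V c\<close> for every minimizer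
  \<open>c\<close>, vanishing spread and a subsequence along which the objective tends to its minimum; taking
  \<open>c\<close> to be a limit point of that subsequence forces \<open>V c \<longlonglongrightarrow> 0\<close>.\<close>

section \<open>Convergence of almost decreasing sequences\<close>

text \<open>Unrolling the recursion with \<open>1 + a t \<le> exp (a t)\<close> bounds
  \<open>V\<close> by a constant \<open>K\<close>, so the factor \<open>1 + a t\<close> costs only
  the summable amount \<open>a t * K\<close>. Subtracting the accumulated errors \<open>d\<close>
  from \<open>V\<close> then leaves a decreasing sequence bounded below, and telescoping bounds the
  partial sums of \<open>c\<close>.\<close>

lemma robbins_siegmund:
  fixes V a b c :: "nat \<Rightarrow> real"
  assumes V: "\<And>t. 0 \<le> V t" and a: "\<And>t. 0 \<le> a t" and b: "\<And>t. 0 \<le> b t" and c: "\<And>t. 0 \<le> c t"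
    and step: "\<And>t. V (Suc t) \<le> (1 + a t) * V t + b t - c t"
    and sa: "summable a" and sb: "summable b"
  shows "convergent V" and "summable c"
proof -
  have bound: "V t \<le> exp (\<Sum>s<t. a s) * (V 0 + (\<Sum>s<t. b s))" for t
  proof (induction t)
    case (Suc t)
    let ?S = "\<Sum>s<t. a s" and ?B = "V 0 + (\<Sum>s<t. b s)"
    have B: "0 \<le> ?B" "0 \<le> ?S" using V b a by (auto intro!: add_nonneg_nonneg sum_nonneg)
    have "V (Suc t) \<le> (1 + a t) * V t + b t" using step[of t] c[of t] by linarith
    also have "\<dots> \<le> exp (a t) * (exp ?S * ?B) + b t"
      using Suc a[of t] V[of t] B by (intro add_right_mono mult_mono) auto
    \<comment> \<open>Inflating \<open>b t\<close> by a factor at least 1 allows the common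
      exponential to be factored out.\<close>
    also have "\<dots> \<le> exp (a t) * (exp ?S * ?B) + exp (a t + ?S) * b t"
      using b[of t] a[of t] B by (simp add: mult_le_cancel_right1)
    finally show ?case by (simp add: exp_add algebra_simps)
  qed simp
  define K where "K = exp (suminf a) * (V 0 + suminf b)"
  have K: "V t \<le> K" for t
  proof -
    have "exp (\<Sum>s<t. a s) * (V 0 + (\<Sum>s<t. b s)) \<le> K"
      unfolding K_def using a b V sa sb
      by (intro mult_mono add_mono sum_le_suminf add_nonneg_nonneg sum_nonneg) (auto intro: sum_le_suminf)
    with bound[of t] show ?thesis by linarith
  qed
  define d where "d t = a t * K + b t" for t
  have d0: "0 \<le> d t" for t
    using a[of t] b[of t] K[of 0] V[of 0] by (simp add: d_def)
  have sd: "summable d" unfolding d_def by (intro summable_add summable_mult2 sa sb)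
  have step': "V (Suc t) \<le> V t + d t - c t" for t
    using step[of t] mult_left_mono[OF K a, of t t] by (simp add: d_def algebra_simps)
  have tele: "V t + (\<Sum>s<t. c s) \<le> V 0 + (\<Sum>s<t. d s)" for t
  proof (induction t)
    case (Suc t) then show ?case using step'[of t] by simp
  qed simp
  show "summable c"
  proof (rule bounded_imp_summable[OF c])
    fix n
    show "(\<Sum>s\<le>n. c s) \<le> V 0 + suminf d"
      using tele[of "Suc n"] V[of "Suc n"] sum_le_suminf[OF sd, of "{..<Suc n}"] d0
      by (simp add: lessThan_Suc_atMost)
  qed
  let ?D = "\<lambda>t. V t - (\<Sum>s<t. d s)"
  have "decseq ?D"
    using step' c by (intro decseq_SucI) (simp, smt (verit))
  moreover have "- suminf d \<le> ?D t" for t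
    using V[of t] sum_le_suminf[OF sd, of "{..<t}"] d0 by auto
  ultimately obtain l where "?D \<longlonglongrightarrow> l"
    using decseq_convergent[of ?D "- suminf d"] by blast
  then have "(\<lambda>t. ?D t + (\<Sum>s<t. d s)) \<longlonglongrightarrow> l + suminf d"
    by (intro tendsto_add summable_LIMSEQ sd)
  then show "convergent V" by (auto simp: convergent_def)
qed

section \<open>Existence of subgradients\<close>

text \<open>A hyperplane separates \<open>(x, f x)\<close> from the strict epigraph
  \<open>S\<close>. Its normal has a positive vertical component \<open>s\<close>, and dividing by
  \<open>s\<close> turns the horizontal component into a subgradient.\<close>

lemma subgradient_exists:
  fixes f :: "'a::euclidean_space \<Rightarrow> real"
  assumes f: "convex_on UNIV f"
  obtains g where "g \<in> subdifferential f x"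
proof -
  define S where "S = {(y, r). f y < r}"
  have "convex S"
  proof (rule convexI)
    fix p q :: "'a \<times> real" and u v :: real
    assume pq: "p \<in> S" "q \<in> S" and uv: "0 \<le> u" "0 \<le> v" "u + v = 1"
    have "f (u *\<^sub>R fst p + v *\<^sub>R fst q) \<le> u * f (fst p) + v * f (fst q)"
      using f uv unfolding convex_on_def by blast
    also have "\<dots> < u * snd p + v * snd q"
    \<comment> \<open>Strictness has to come from a point of positive weight: the second one if
      \<open>u = 0\<close>, otherwise the first.\<close>
    proof (cases "u = 0")
      case True then show ?thesis using pq uv by (auto simp: S_def)
    next
      case False
      then have "u * f (fst p) < u * snd p" using pq uv by (auto simp: S_def)
      moreover have "v * f (fst q) \<le> v * snd q" using pq uv by (auto simp: S_def intro!: mult_left_mono)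
      ultimately show ?thesis by linarith
    qed
    finally show "u *\<^sub>R p + v *\<^sub>R q \<in> S" by (cases p, cases q) (auto simp: S_def)
  qed
  moreover have "(x, f x + 1) \<in> S" by (simp add: S_def)
  moreover have "{(x, f x)} \<inter> S = {}" by (auto simp: S_def)
  ultimately obtain n c where nz: "n \<noteq> 0" and lo: "n \<bullet> (x, f x) \<le> c" and hi: "\<forall>q\<in>S. c \<le> n \<bullet> q"
    using separating_hyperplane_sets[of "{(x, f x)}" S]
    by (metis convex_singleton empty_iff insert_not_empty singletonI)
  obtain p s where n: "n = (p, s)" by (cases n)
  have sep: "p \<bullet> x + s * f x \<le> p \<bullet> y + s * r" if "f y < r" for y r
    using lo hi[rule_format, of "(y, r)"] that by (simp add: n S_def)
  have "0 \<le> s" using sep[of x "f x + 1"] by (simp add: algebra_simps)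
  moreover have "s \<noteq> 0"
  proof
    assume s: "s = 0"
    \<comment> \<open>A vertical hyperplane would put all of space on one side of \<open>x\<close>;
      moving against \<open>p\<close> refutes this unless \<open>p = 0\<close>.\<close>
    have "p \<bullet> x \<le> p \<bullet> (x - p)" using sep[of "x - p" "f (x - p) + 1"] s by simp
    then have "p \<bullet> p \<le> 0" by (simp add: inner_diff_right)
    then have "p = 0" by (metis inner_eq_zero_iff inner_ge_zero order_antisym)
    with nz s n show False by (simp add: zero_prod_def)
  qed
  ultimately have s: "0 < s" by simp
  have "f x + (- (1 / s) *\<^sub>R p) \<bullet> (y - x) \<le> f y" for y
  \<comment> \<open>The graph itself is not in \<open>S\<close>, so the separation is tested at
    height \<open>f y + e\<close>.\<close>
  proof (rule field_le_epsilon)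
    fix e :: real assume "0 < e"
    then have "p \<bullet> x + s * f x \<le> p \<bullet> y + s * (f y + e)" by (intro sep) simp
    then show "f x + (- (1 / s) *\<^sub>R p) \<bullet> (y - x) \<le> f y + e"
      using s by (simp add: field_simps inner_diff_right)
  qed
  then show ?thesis by (intro that[of "- (1 / s) *\<^sub>R p"]) (simp add: subdifferential_def)
qed

section \<open>Variance identity and disagreement\<close>

text \<open>Parallel axis theorem: the cross terms cancel because the weighted deviations from the
  weighted mean sum to zero.\<close>

lemma weighted_variance:
  fixes x :: "'i::finite \<Rightarrow> 'a::real_inner"
  assumes "(\<Sum>j\<in>UNIV. w j) = 1"
  shows "(\<Sum>j\<in>UNIV. w j * (norm (x j - c))\<^sup>2) =
    (norm ((\<Sum>j\<in>UNIV. w j *\<^sub>R x j) - c))\<^sup>2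
      + (\<Sum>j\<in>UNIV. w j * (norm (x j - (\<Sum>k\<in>UNIV. w k *\<^sub>R x k)))\<^sup>2)"
proof -
  define y where "y = (\<Sum>k\<in>UNIV. w k *\<^sub>R x k)"
  have *: "(norm (x j - c))\<^sup>2 = (norm (y - c))\<^sup>2 + (norm (x j - y))\<^sup>2 + 2 * ((x j - y) \<bullet> (y - c))" for j
    by (simp add: power2_norm_eq_inner algebra_simps inner_commute)
  have "w j * (norm (x j - c))\<^sup>2 = w j * (norm (y - c))\<^sup>2 + w j * (norm (x j - y))\<^sup>2
      + 2 * ((w j *\<^sub>R x j - w j *\<^sub>R y) \<bullet> (y - c))" for j
    unfolding * by (simp add: distrib_left flip: scaleR_diff_right)
  then have "(\<Sum>j\<in>UNIV. w j * (norm (x j - c))\<^sup>2) =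
      (\<Sum>j\<in>UNIV. w j * (norm (y - c))\<^sup>2 + w j * (norm (x j - y))\<^sup>2 + 2 * ((w j *\<^sub>R x j - w j *\<^sub>R y) \<bullet> (y - c)))"
    by simp
  also have "\<dots> = (norm (y - c))\<^sup>2 + (\<Sum>j\<in>UNIV. w j * (norm (x j - y))\<^sup>2)
      + 2 * ((\<Sum>j\<in>UNIV. w j *\<^sub>R x j - w j *\<^sub>R y) \<bullet> (y - c))"
    using assms by (simp add: sum.distrib inner_sum_left flip: sum_distrib_left sum_distrib_right)
  also have "(\<Sum>j\<in>UNIV. w j *\<^sub>R x j - w j *\<^sub>R y) = 0"
    using assms by (simp add: sum_subtractf y_def flip: scaleR_left.sum)
  finally show ?thesis by (simp add: y_def)
qed

text \<open>Equivalent to the diameter of the family, but as a sum it can be estimated term by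
  term.\<close>

definition spread :: "('n::finite \<Rightarrow> 'a::real_normed_vector) \<Rightarrow> real" where
  "spread x = (\<Sum>i\<in>UNIV. \<Sum>j\<in>UNIV. norm (x i - x j))"

lemma spread_nonneg: "0 \<le> spread x"
  unfolding spread_def by (intro sum_nonneg) auto

lemma norm_diff_le_spread: "norm (x i - x j) \<le> spread x"
proof -
  have "norm (x i - x j) \<le> (\<Sum>j\<in>UNIV. norm (x i - x j))"
    by (rule member_le_sum[of j UNIV "\<lambda>j. norm (x i - x j)"]) auto
  also have "\<dots> \<le> spread x" unfolding spread_def
    by (rule member_le_sum[of i UNIV "\<lambda>i. \<Sum>j\<in>UNIV. norm (x i - x j)"]) (auto intro: sum_nonneg)
  finally show ?thesis .
qed

lemma average_near_points:
  fixes x :: "'n::finite \<Rightarrow> 'a::real_normed_vector"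
  assumes "\<And>j. 0 \<le> w j" "(\<Sum>j\<in>UNIV. w j) = 1"
  shows "norm ((\<Sum>j\<in>UNIV. w j *\<^sub>R x j) - x k) \<le> spread x"
proof -
  have "(\<Sum>j\<in>UNIV. w j *\<^sub>R x j) - x k = (\<Sum>j\<in>UNIV. w j *\<^sub>R (x j - x k))"
    using assms(2) by (simp add: scaleR_diff_right sum_subtractf flip: scaleR_left.sum)
  also have "norm \<dots> \<le> (\<Sum>j\<in>UNIV. w j * spread x)"
    using assms(1) norm_diff_le_spread[of x]
    by (intro sum_norm_le) (auto intro!: mult_left_mono)
  finally show ?thesis using assms(2) by (simp flip: sum_distrib_right)
qed

text \<open>Needed for Algorithm 2, where averaging acts on points already moved by a gradient step,
  while the decrease is wanted in terms of the iterates.\<close>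

lemma spread_perturb:
  fixes x q :: "'n::finite \<Rightarrow> 'a::real_normed_vector"
  assumes "\<And>i. norm (x i - q i) \<le> b"
  shows "spread x \<le> spread q + real CARD('n) * (real CARD('n) * (2 * b))"
proof -
  have "norm (x i - x j) \<le> norm (q i - q j) + 2 * b" for i j
  proof -
    have "x i - x j = (q i - q j) + (x i - q i) - (x j - q j)" by simp
    then have "norm (x i - x j) \<le> norm (q i - q j) + norm (x i - q i) + norm (x j - q j)"
      by (metis (no_types, lifting) norm_triangle_ineq norm_triangle_ineq4 add_right_mono order_trans)
    with assms[of i] assms[of j] show ?thesis by linarith
  qed
  then have "spread x \<le> (\<Sum>i\<in>(UNIV::'n set). \<Sum>j\<in>(UNIV::'n set). norm (q i - q j) + 2 * b)"
    unfolding spread_def by (intro sum_mono)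
  also have "\<dots> = spread q + real CARD('n) * (real CARD('n) * (2 * b))"
    by (simp add: spread_def sum.distrib)
  finally show ?thesis .
qed

section \<open>Averaging contracts towards consensus\<close>

text \<open>\<open>p\<close> is the normalized left Perron vector of \<open>w\<close>;
  irreducibility refers to the graph of positive entries.\<close>

locale stationary_weights =
  fixes w :: "'n::finite \<Rightarrow> 'n \<Rightarrow> real" and p :: "'n \<Rightarrow> real"
  assumes w_nonneg: "0 \<le> w i j"
    and row_sum: "(\<Sum>j\<in>UNIV. w i j) = 1"
    and diag_pos: "0 < w i i"
    and irreducible: "(i, j) \<in> {(i, j). 0 < w i j}\<^sup>*"
    and p_pos: "0 < p i"
    and p_sum: "(\<Sum>i\<in>UNIV. p i) = 1"
    and stationary: "(\<Sum>i\<in>UNIV. p i * w i j) = p j"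
begin

lemma stationary_sum: "(\<Sum>i\<in>UNIV. p i * (\<Sum>j\<in>UNIV. w i j * h j)) = (\<Sum>j\<in>UNIV. p j * h j)"
proof -
  have "(\<Sum>i\<in>UNIV. p i * (\<Sum>j\<in>UNIV. w i j * h j)) = (\<Sum>j\<in>UNIV. \<Sum>i\<in>UNIV. p i * w i j * h j)"
    by (subst sum.swap) (simp add: sum_distrib_left mult.assoc)
  then show ?thesis by (simp add: stationary flip: sum_distrib_right)
qed

text \<open>The \<open>p\<close>-weighted mean of the variances that the agents see in their own
  rows; by the next lemma it is exactly what one averaging step removes.\<close>

definition dispersion :: "('n \<Rightarrow> 'a::real_inner) \<Rightarrow> real" where
  "dispersion x = (\<Sum>i\<in>UNIV. p i * (\<Sum>j\<in>UNIV. w i j * (norm (x j - (\<Sum>k\<in>UNIV. w i k *\<^sub>R x k)))\<^sup>2))"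

text \<open>The variance identity is applied in each row, and stationarity collapses the double sum.
  The loss is the same for every \<open>c\<close>, so a single constant later serves all reference
  points.\<close>

lemma averaging_identity:
  fixes x :: "'n \<Rightarrow> 'a::real_inner"
  shows "(\<Sum>i\<in>UNIV. p i * (norm ((\<Sum>j\<in>UNIV. w i j *\<^sub>R x j) - c))\<^sup>2) + dispersion x
    = (\<Sum>i\<in>UNIV. p i * (norm (x i - c))\<^sup>2)"
  by (simp add: dispersion_def weighted_variance[OF row_sum, of _ _ c] sum.distrib distrib_left
      flip: stationary_sum[of "\<lambda>j. (norm (x j - c))\<^sup>2"])

text \<open>Induction along a path from \<open>i\<close> to \<open>j\<close>. For an edge from
  \<open>j\<close> to \<open>k\<close>, both \<open>x j\<close> and \<open>x k\<close> lie close to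
  the row average of \<open>j\<close>: the first by the positive diagonal, the second by the
  positive weight of the edge.\<close>

lemma pair_le_dispersion:
  "\<exists>C\<ge>0. \<forall>x :: 'n \<Rightarrow> 'a::real_inner. norm (x i - x j) \<le> C * sqrt (dispersion x)"
  using irreducible[of i j]
proof (induction rule: rtrancl_induct)
  case base
  show ?case by (intro exI[of _ 0]) auto
next
  case (step j k)
  then obtain C where C: "0 \<le> C" "\<And>x :: 'n \<Rightarrow> 'a. norm (x i - x j) \<le> C * sqrt (dispersion x)" by blast
  have wjk: "0 < w j k" using step by simp
  \<comment> \<open>A single summand of the nonnegative double sum \<open>dispersion x\<close> gives
    this bound.\<close>
  have near: "norm (x l - (\<Sum>k\<in>UNIV. w j k *\<^sub>R x k)) \<le> sqrt (1 / (p j * w j l)) * sqrt (dispersion x)"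
    if l: "0 < w j l" for l and x :: "'n \<Rightarrow> 'a"
  proof -
    let ?y = "\<lambda>j. \<Sum>k\<in>UNIV. w j k *\<^sub>R x k"
    have "w j l * (norm (x l - ?y j))\<^sup>2 \<le> (\<Sum>m\<in>UNIV. w j m * (norm (x m - ?y j))\<^sup>2)"
      by (rule member_le_sum[of l UNIV "\<lambda>m. w j m * (norm (x m - ?y j))\<^sup>2"]) (auto simp: w_nonneg)
    then have "p j * (w j l * (norm (x l - ?y j))\<^sup>2) \<le> p j * (\<Sum>m\<in>UNIV. w j m * (norm (x m - ?y j))\<^sup>2)"
      using p_pos[of j] by (intro mult_left_mono) auto
    also have "\<dots> \<le> dispersion x" unfolding dispersion_def
      by (rule member_le_sum[of j UNIV "\<lambda>j. p j * (\<Sum>m\<in>UNIV. w j m * (norm (x m - ?y j))\<^sup>2)"])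
        (auto intro!: sum_nonneg mult_nonneg_nonneg simp: w_nonneg less_imp_le[OF p_pos])
    finally have "(norm (x l - ?y j))\<^sup>2 \<le> 1 / (p j * w j l) * dispersion x"
      using p_pos[of j] l by (simp add: field_simps)
    then show ?thesis
      by (metis real_sqrt_le_mono real_sqrt_mult real_sqrt_abs abs_norm_cancel)
  qed
  let ?K = "sqrt (1 / (p j * w j j)) + sqrt (1 / (p j * w j k))"
  have "norm (x i - x k) \<le> (C + ?K) * sqrt (dispersion x)" for x :: "'n \<Rightarrow> 'a"
  proof -
    let ?y = "\<Sum>k\<in>UNIV. w j k *\<^sub>R x k"
    have "norm (x i - x k) \<le> norm (x i - x j) + norm (x j - ?y) + norm (x k - ?y)"
      by norm
    with C(2)[of x] near[OF diag_pos, of x] near[OF wjk, of x] show ?thesis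
      by (simp add: distrib_right)
  qed
  moreover have "0 \<le> C + ?K" using C p_pos[of j] diag_pos[of j] wjk by auto
  ultimately show ?case by blast
qed

lemma dispersion_nonneg: "0 \<le> dispersion x"
  unfolding dispersion_def
  by (auto intro!: sum_nonneg mult_nonneg_nonneg simp: w_nonneg less_imp_le[OF p_pos])

lemma spread_le_dispersion:
  obtains \<kappa> where "0 < \<kappa>" "\<And>x :: 'n \<Rightarrow> 'a::real_inner. \<kappa> * (spread x)\<^sup>2 \<le> dispersion x"
proof -
  obtain C where C: "\<And>i j. 0 \<le> C i j"
    "\<And>i j (x :: 'n \<Rightarrow> 'a). norm (x i - x j) \<le> C i j * sqrt (dispersion x)"
    using pair_le_dispersion[where 'a='a] by metis
  define K where "K = (\<Sum>i\<in>UNIV. \<Sum>j\<in>UNIV. C i j)"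
  \<comment> \<open>The added 1 keeps the denominator positive even if \<open>K = 0\<close>, as may
    happen with a single agent.\<close>
  have "1 / (K\<^sup>2 + 1) * (spread x)\<^sup>2 \<le> dispersion x" for x :: "'n \<Rightarrow> 'a"
  proof -
    have "spread x \<le> K * sqrt (dispersion x)"
      unfolding spread_def K_def sum_distrib_right by (intro sum_mono C)
    then have "(spread x)\<^sup>2 \<le> (K * sqrt (dispersion x))\<^sup>2"
      by (intro power_mono spread_nonneg)
    also have "\<dots> \<le> (K\<^sup>2 + 1) * dispersion x"
      by (simp add: power_mult_distrib dispersion_nonneg algebra_simps)
    finally show ?thesis
      by (simp add: field_simps add_pos_nonneg)
  qed
  moreover have "0 < 1 / (K\<^sup>2 + 1)" by (simp add: add_nonneg_pos)
  ultimately show ?thesis using that by blast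
qed

lemma averaging_contraction:
  obtains \<kappa> where "0 < \<kappa>"
    "\<And>(x :: 'n \<Rightarrow> 'a::real_inner) c.
      (\<Sum>i\<in>UNIV. p i * (norm ((\<Sum>j\<in>UNIV. w i j *\<^sub>R x j) - c))\<^sup>2)
        \<le> (\<Sum>i\<in>UNIV. p i * (norm (x i - c))\<^sup>2) - \<kappa> * (spread x)\<^sup>2"
proof -
  obtain \<kappa> where k: "0 < \<kappa>" "\<And>x :: 'n \<Rightarrow> 'a. \<kappa> * (spread x)\<^sup>2 \<le> dispersion x"
    using spread_le_dispersion[where 'a='a] by blast
  show ?thesis
  proof (rule that[OF k(1)])
    fix x :: "'n \<Rightarrow> 'a" and c
    show "(\<Sum>i\<in>UNIV. p i * (norm ((\<Sum>j\<in>UNIV. w i j *\<^sub>R x j) - c))\<^sup>2)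
        \<le> (\<Sum>i\<in>UNIV. p i * (norm (x i - c))\<^sup>2) - \<kappa> * (spread x)\<^sup>2"
      using averaging_identity[of x c] k(2)[of x] by linarith
  qed
qed

end

section \<open>Existence of the stationary distribution\<close>

lemma convex_prob_simplex: "convex {v :: real^'n. (\<forall>i. 0 \<le> v $ i) \<and> (\<Sum>i\<in>UNIV. v $ i) = 1}"
proof (rule convexI)
  let ?S = "{v :: real^'n. (\<forall>i. 0 \<le> v $ i) \<and> (\<Sum>i\<in>UNIV. v $ i) = 1}"
  fix x y and a b :: real
  assume *: "x \<in> ?S" "y \<in> ?S" "0 \<le> a" "0 \<le> b" "a + b = 1"
  then have "(\<Sum>i\<in>UNIV. a * x $ i + b * y $ i) = 1"
    unfolding sum.distrib sum_distrib_left[symmetric] by simp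
  with * show "a *\<^sub>R x + b *\<^sub>R y \<in> ?S" by simp
qed

text \<open>Brouwer's theorem for \<open>T\<close> on the probability simplex gives a stationary
  vector. Some coordinate is positive, and stationarity spreads positivity along the arrows, which
  reach every agent.\<close>

lemma stationary_weights_exist:
  fixes w :: "'n::finite \<Rightarrow> 'n \<Rightarrow> real"
  assumes w: "\<And>i j. 0 \<le> w i j" and row: "\<And>i. (\<Sum>j\<in>UNIV. w i j) = 1" and diag: "\<And>i. 0 < w i i"
    and irr: "\<And>i j. (i, j) \<in> {(i, j). 0 < w i j}\<^sup>*"
  obtains p where "stationary_weights w p"
proof -
  define S :: "(real^'n) set" where "S = {v. (\<forall>i. 0 \<le> v $ i) \<and> (\<Sum>i\<in>UNIV. v $ i) = 1}"
  define T :: "real^'n \<Rightarrow> real^'n" where "T v = (\<chi> j. \<Sum>i\<in>UNIV. v $ i * w i j)" for v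
  have "bounded S"
  proof (rule boundedI)
    fix v assume "v \<in> S"
    then show "norm v \<le> 1" using norm_le_l1_cart[of v] by (simp add: S_def)
  qed
  moreover have "closed S"
    unfolding S_def
    by (intro closed_Collect_conj closed_Collect_all closed_Collect_le closed_Collect_eq
        continuous_on_sum continuous_on_component continuous_on_const continuous_on_id)
  ultimately have "compact S" by (simp add: compact_eq_bounded_closed)
  moreover have "convex S" unfolding S_def by (rule convex_prob_simplex)
  moreover have "axis undefined 1 \<in> S" by (simp add: S_def axis_def)
  then have "S \<noteq> {}" by blast
  moreover have "continuous_on S T" unfolding T_def by (intro continuous_intros)
  moreover have "T \<in> S \<rightarrow> S"
  proof
    fix v assume v: "v \<in> S"
    have "(\<Sum>j\<in>UNIV. T v $ j) = (\<Sum>i\<in>UNIV. v $ i * (\<Sum>j\<in>UNIV. w i j))"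
      unfolding T_def by (simp add: sum_distrib_left) (rule sum.swap)
    with v show "T v \<in> S"
      by (auto simp: S_def T_def row w intro!: sum_nonneg)
  qed
  ultimately obtain v where v: "v \<in> S" "T v = v" by (rule brouwer)
  have fixed: "(\<Sum>i\<in>UNIV. v $ i * w i j) = v $ j" for j
    using arg_cong[OF v(2), of "\<lambda>u. u $ j"] by (simp add: T_def)
  have v0: "0 \<le> v $ i" for i using v(1) by (simp add: S_def)
  have "\<exists>i. 0 < v $ i"
  proof (rule ccontr)
    assume "\<nexists>i. 0 < v $ i"
    then have "v $ i = 0" for i using v0[of i] by (auto simp: not_less intro: antisym)
    with v(1) show False by (simp add: S_def)
  qed
  then obtain k where k: "0 < v $ k" ..
  have pos: "0 < v $ i" for i
    using irr[of k i]
  proof (induction rule: rtrancl_induct)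
    case (step i j)
    then have "0 < v $ i * w i j" by simp
    also have "\<dots> \<le> v $ j" unfolding fixed[of j, symmetric]
      by (rule member_le_sum[of i UNIV "\<lambda>i. v $ i * w i j"]) (auto simp: v0 w)
    finally show ?case .
  qed (rule k)
  have "stationary_weights w (\<lambda>i. v $ i)"
    by (intro stationary_weights.intro w row diag irr pos fixed) (use v(1) in \<open>simp add: S_def\<close>)
  then show ?thesis by (rule that)
qed

section \<open>Geometric consensus and the \<open>z\<close>-iteration\<close>

context stationary_weights
begin

lemma stationary_vector_sum:
  fixes h :: "'n \<Rightarrow> 'a::real_vector"
  shows "(\<Sum>i\<in>UNIV. p i *\<^sub>R (\<Sum>j\<in>UNIV. w i j *\<^sub>R h j)) = (\<Sum>j\<in>UNIV. p j *\<^sub>R h j)"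
proof -
  have "(\<Sum>i\<in>UNIV. p i *\<^sub>R (\<Sum>j\<in>UNIV. w i j *\<^sub>R h j)) = (\<Sum>j\<in>UNIV. \<Sum>i\<in>UNIV. (p i * w i j) *\<^sub>R h j)"
    by (subst sum.swap) (simp add: scaleR_sum_right)
  then show ?thesis by (simp add: stationary flip: scaleR_left.sum)
qed

text \<open>The \<open>p\<close>-mean \<open>c\<close> is conserved, so every agent is within the
  spread of \<open>c\<close>. The decrease in the contraction thus dominates a multiple of
  \<open>H\<close> itself, and \<open>H\<close> decays geometrically, as does its square
  root.\<close>

lemma consensus_summable:
  fixes z :: "nat \<Rightarrow> 'n \<Rightarrow> 'a::real_inner"
  assumes step: "\<And>t i. z (Suc t) i = (\<Sum>j\<in>UNIV. w i j *\<^sub>R z t j)"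
  shows "summable (\<lambda>t. norm (z t i - (\<Sum>j\<in>UNIV. p j *\<^sub>R z 0 j)))"
proof -
  define c where "c = (\<Sum>j\<in>UNIV. p j *\<^sub>R z 0 j)"
  define H where "H t = (\<Sum>i\<in>UNIV. p i * (norm (z t i - c))\<^sup>2)" for t
  obtain \<kappa> where \<kappa>: "0 < \<kappa>" and contr: "\<And>(x :: 'n \<Rightarrow> 'a) c.
      (\<Sum>i\<in>UNIV. p i * (norm ((\<Sum>j\<in>UNIV. w i j *\<^sub>R x j) - c))\<^sup>2)
        \<le> (\<Sum>i\<in>UNIV. p i * (norm (x i - c))\<^sup>2) - \<kappa> * (spread x)\<^sup>2"
    using averaging_contraction[where 'a='a] by blast
  have mean: "(\<Sum>j\<in>UNIV. p j *\<^sub>R z t j) = c" for t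
    by (induction t) (simp_all add: c_def step stationary_vector_sum)
  have near: "norm (z t i - c) \<le> spread (z t)" for t i
    using average_near_points[of p "z t" i] p_pos p_sum
    by (simp add: mean less_imp_le norm_minus_commute)
  have H0: "0 \<le> H t" for t
    unfolding H_def by (auto intro!: sum_nonneg mult_nonneg_nonneg simp: less_imp_le[OF p_pos])
  have H_le: "H t \<le> (spread (z t))\<^sup>2" for t
  proof -
    have "H t \<le> (\<Sum>i\<in>UNIV. p i * (spread (z t))\<^sup>2)"
      unfolding H_def by (intro sum_mono mult_left_mono power_mono near) (auto simp: less_imp_le[OF p_pos])
    then show ?thesis by (simp add: p_sum flip: sum_distrib_right)
  qed
  \<comment> \<open>Nothing bounds \<open>\<kappa>\<close> by 1 here; truncation keeps the ratio
    nonnegative.\<close>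
  define r where "r = max 0 (1 - \<kappa>)"
  have r: "0 \<le> r" "r < 1" using \<kappa> by (auto simp: r_def)
  have "H (Suc t) \<le> r * H t" for t
  proof -
    have "H (Suc t) \<le> H t - \<kappa> * (spread (z t))\<^sup>2"
      unfolding H_def step by (rule contr)
    also have "\<dots> \<le> (1 - \<kappa>) * H t" using mult_left_mono[OF H_le[of t]] \<kappa> by (simp add: algebra_simps)
    also have "\<dots> \<le> r * H t" by (intro mult_right_mono H0) (simp add: r_def)
    finally show ?thesis .
  qed
  then have Hr: "H t \<le> r ^ t * H 0" for t
  proof (induction t)
    case (Suc t)
    have "H (Suc t) \<le> r * H t" by fact
    also have "\<dots> \<le> r * (r ^ t * H 0)" using Suc r by (intro mult_left_mono) auto
    finally show ?case by (simp add: mult.assoc)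
  qed simp
  have "norm (z t i - c) \<le> sqrt (H 0 / p i) * sqrt r ^ t" for t
  proof -
    have "p i * (norm (z t i - c))\<^sup>2 \<le> H t" unfolding H_def
      by (rule member_le_sum[of i UNIV "\<lambda>i. p i * (norm (z t i - c))\<^sup>2"]) (auto simp: less_imp_le[OF p_pos])
    also note Hr[of t]
    finally have "(norm (z t i - c))\<^sup>2 \<le> H 0 / p i * r ^ t"
      using p_pos[of i] by (simp add: field_simps)
    then have "norm (z t i - c) \<le> sqrt (H 0 / p i * r ^ t)" by (rule real_le_rsqrt)
    then show ?thesis by (simp only: real_sqrt_mult real_sqrt_power)
  qed
  then have le: "norm (norm (z t i - c)) \<le> sqrt (H 0 / p i) * sqrt r ^ t" for t by simp
  have "summable (\<lambda>t. sqrt (H 0 / p i) * sqrt r ^ t)"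
    using r by (intro summable_mult summable_geometric) simp
  then show ?thesis
    unfolding c_def[symmetric] by (rule summable_comparison_test'[where N=0]) (rule le)
qed

end

lemma z_seq_diag_pos:
  assumes "\<And>i j. 0 \<le> W $ i $ j" "\<And>i. 0 < W $ i $ i"
  shows "0 < z_seq W t i $ i"
proof -
  have nn: "0 \<le> z_seq W t i $ k" for t i k
    by (induction t arbitrary: i) (auto simp: axis_def assms intro!: sum_nonneg)
  show ?thesis
  proof (induction t)
    case (Suc t)
    then have "0 < W $ i $ i * z_seq W t i $ i" by (simp add: assms)
    also have "\<dots> \<le> z_seq W (Suc t) i $ i"
      by (simp, rule member_le_sum[of i UNIV "\<lambda>j. W $ i $ j * z_seq W t j $ i"]) (auto simp: nn assms)
    finally show ?case .
  qed simp
qed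

text \<open>The vectors \<open>z_seq W t i\<close> are the rows of the \<open>t\<close>-th power of
  \<open>W\<close>. The \<open>p\<close>-mean of the initial unit vectors is \<open>p\<close>, so
  consensus drives the diagonal entries to \<open>p i\<close> with summable error. Being positive
  with a positive limit, these entries have bounded reciprocals.\<close>

lemma z_seq_scaling:
  assumes st: "stationary_weights (\<lambda>i j. W $ i $ j) p"
  obtains K where "0 < K" "\<And>t i. 0 < z_seq W t i $ i" "\<And>t i. 1 / z_seq W t i $ i \<le> K"
    "\<And>i. summable (\<lambda>t. \<bar>p i / z_seq W t i $ i - 1\<bar>)"
proof -
  interpret stationary_weights "\<lambda>i j. W $ i $ j" p by (rule st)
  have pos: "0 < z_seq W t i $ i" for t i
    by (intro z_seq_diag_pos) (auto simp: w_nonneg diag_pos)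
  have sm: "summable (\<lambda>t. \<bar>z_seq W t i $ i - p i\<bar>)" for i
  proof (rule summable_comparison_test'[where N=0])
    show "summable (\<lambda>t. norm (z_seq W t i - (\<Sum>j\<in>UNIV. p j *\<^sub>R z_seq W 0 j)))"
      by (rule consensus_summable) simp
    fix t
    have "(\<Sum>j\<in>UNIV. p j *\<^sub>R z_seq W 0 j) $ i = p i"
      by (simp add: axis_def if_distrib cong: if_cong)
    then show "norm \<bar>z_seq W t i $ i - p i\<bar> \<le> norm (z_seq W t i - (\<Sum>j\<in>UNIV. p j *\<^sub>R z_seq W 0 j))"
      using component_le_norm_cart[of "z_seq W t i - (\<Sum>j\<in>UNIV. p j *\<^sub>R z_seq W 0 j)" i] by simp
  qed
  have "\<exists>K>0. \<forall>t. 1 / z_seq W t i $ i \<le> K" for i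
  proof -
    have "(\<lambda>t. z_seq W t i $ i - p i) \<longlonglongrightarrow> 0"
      using summable_LIMSEQ_zero[OF sm[of i]] by (rule tendsto_rabs_zero_cancel)
    then have "(\<lambda>t. z_seq W t i $ i) \<longlonglongrightarrow> p i" by (rule LIM_zero_cancel)
    then have "(\<lambda>t. 1 / z_seq W t i $ i) \<longlonglongrightarrow> 1 / p i"
      using p_pos[of i] by (intro tendsto_intros) auto
    then have "Bseq (\<lambda>t. 1 / z_seq W t i $ i)" by (intro convergent_imp_Bseq) (auto simp: convergent_def)
    then obtain K where "0 < K" "\<And>t. norm (1 / z_seq W t i $ i) \<le> K" by (auto elim!: BseqE)
    then show ?thesis using pos by (auto simp: abs_of_pos)
  qed
  then obtain K where K: "\<And>i. 0 < K i" "\<And>i t. 1 / z_seq W t i $ i \<le> K i" by metis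
  define M where "M = (\<Sum>i\<in>UNIV. K i)"
  have KM: "K i \<le> M" for i
    unfolding M_def by (rule member_le_sum) (auto simp: less_imp_le[OF K(1)])
  show ?thesis
  proof (rule that[of M, OF _ pos])
    show "0 < M" using K(1) KM less_le_trans by blast
    show "1 / z_seq W t i $ i \<le> M" for t i using K(2) KM order_trans by blast
    show "summable (\<lambda>t. \<bar>p i / z_seq W t i $ i - 1\<bar>)" for i
    proof (rule summable_comparison_test'[where N=0])
      show "summable (\<lambda>t. K i * \<bar>z_seq W t i $ i - p i\<bar>)" by (intro summable_mult sm)
      fix t
      have "p i / z_seq W t i $ i - 1 = - (1 / z_seq W t i $ i * (z_seq W t i $ i - p i))"
        using pos[of t i] by (simp add: field_simps)
      then have "\<bar>p i / z_seq W t i $ i - 1\<bar> = 1 / z_seq W t i $ i * \<bar>z_seq W t i $ i - p i\<bar>"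
        using pos[of t i] by (simp add: abs_mult)
      then show "norm \<bar>p i / z_seq W t i $ i - 1\<bar> \<le> K i * \<bar>z_seq W t i $ i - p i\<bar>"
        using mult_right_mono[OF K(2)[of t i], of "\<bar>z_seq W t i $ i - p i\<bar>"] by simp
    qed
  qed
qed

section \<open>Auxiliary estimates and subsequences\<close>

text \<open>The point \<open>x i\<close> of another agent is itself a candidate in
  \<open>X i\<close>. Combined with regularity, this makes infeasibility a first-order effect of
  disagreement.\<close>

lemma Max_infdist_le_spread:
  fixes x :: "'n::finite \<Rightarrow> 'a::real_normed_vector"
  assumes "\<And>i. x i \<in> X i"
  shows "(MAX i. infdist (x k) (X i)) \<le> spread x"
proof (rule Max.boundedI)
  fix d assume "d \<in> range (\<lambda>i. infdist (x k) (X i))"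
  then obtain i where "d = infdist (x k) (X i)" by blast
  also have "\<dots> \<le> dist (x k) (x i)" using assms by (rule infdist_le)
  also have "\<dots> \<le> spread x" by (simp add: dist_norm norm_diff_le_spread)
  finally show "d \<le> spread x" .
qed auto

text \<open>If \<open>h\<close> stayed above \<open>e\<close>, then \<open>\<alpha>\<close> would be
  dominated by the summable \<open>\<alpha> t * h t / e\<close>.\<close>

lemma frequently_small_of_summable_product:
  fixes \<alpha> h :: "nat \<Rightarrow> real"
  assumes \<alpha>: "\<And>t. 0 < \<alpha> t" and div: "\<not> summable \<alpha>" and s: "summable (\<lambda>t. \<alpha> t * h t)"
    and "0 < e"
  shows "\<exists>t\<ge>N. h t < e"
proof (rule ccontr)
  assume "\<not> (\<exists>t\<ge>N. h t < e)"
  then have ge: "e \<le> h t" if "N \<le> t" for t using that by (auto simp: not_less)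
  have "norm (\<alpha> t) \<le> \<alpha> t * h t / e" if "N \<le> t" for t
    using mult_left_mono[OF ge[OF that], of "\<alpha> t"] \<alpha>[of t] \<open>0 < e\<close> by (simp add: field_simps)
  with div show False
    using summable_comparison_test'[OF summable_divide[OF s]] by blast
qed

lemma strict_mono_selection:
  assumes "\<And>N (n::nat). \<exists>t\<ge>N. P n t"
  obtains r :: "nat \<Rightarrow> nat" where "strict_mono r" "\<And>n. P n (r n)"
proof -
  obtain s where s: "\<And>N n. s N n \<ge> N" "\<And>N n. P n (s N n)" using assms by metis
  \<comment> \<open>The lower bound \<open>Suc t\<close> forces strict growth while the index of
    \<open>P\<close> advances in parallel.\<close>
  define r where "r = rec_nat (s 0 0) (\<lambda>n t. s (Suc t) (Suc n))"
  have "P n (r n)" for n by (cases n) (auto simp: r_def s)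
  moreover have "strict_mono r"
    by (rule strict_monoI_Suc) (use s(1) in \<open>simp add: r_def less_eq_Suc_le\<close>)
  ultimately show ?thesis using that by blast
qed

text \<open>Completing the square. Half of the quadratic decrease pays for the term linear in the
  disagreement \<open>e\<close>, leaving a remainder of order \<open>a\<close> squared.\<close>

lemma am_gm_absorb:
  fixes \<kappa> a e G :: real
  assumes "0 < \<kappa>"
  shows "2 * a * (G * e) \<le> \<kappa> / 2 * e\<^sup>2 + 2 * G\<^sup>2 / \<kappa> * a\<^sup>2"
proof -
  have "0 \<le> (\<kappa> * e - 2 * G * a)\<^sup>2 / (2 * \<kappa>)" using assms by simp
  also have "\<dots> = \<kappa> / 2 * e\<^sup>2 + 2 * G\<^sup>2 / \<kappa> * a\<^sup>2 - 2 * a * (G * e)"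
    using assms by (simp add: power2_eq_square field_simps)
  finally show ?thesis by simp
qed

section \<open>Convergence of an abstract subgradient iteration\<close>

context stationary_weights
begin

text \<open>Three estimates per agent: passing from \<open>v i\<close> to the common point
  \<open>u\<close> costs \<open>L\<close> times their distance; the subgradient inequality at
  \<open>v i\<close> brings in \<open>c\<close>; replacing \<open>\<eta> i\<close> by 1 costs a
  multiple of \<open>\<bar>\<eta> i - 1\<bar>\<close>, bounded by Cauchy-Schwarz.\<close>

lemma subgradient_iteration_step:
  fixes f :: "'n \<Rightarrow> 'a::euclidean_space \<Rightarrow> real" and x v g :: "'n \<Rightarrow> 'a"
  assumes conv: "\<And>i. convex_on UNIV (f i)"
    and L: "0 < L" "\<And>i y h. y \<in> U \<Longrightarrow> h \<in> subdifferential (f i) y \<Longrightarrow> norm h \<le> L"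
    and u: "u \<in> U" "norm (x k - u) \<le> R * spread x"
    and v: "\<And>i. v i \<in> U" "\<And>i j. norm (v i - x j) \<le> spread x"
    and g: "\<And>i. g i \<in> subdifferential (f i) (v i)"
    and P: "P = (\<Sum>i\<in>UNIV. 1 / p i)"
    and V: "V = (\<Sum>i\<in>UNIV. p i * (norm (x i - c))\<^sup>2)"
    and \<delta>: "\<delta> = (\<Sum>i\<in>UNIV. \<bar>\<eta> i - 1\<bar>)"
  shows "(\<Sum>i\<in>UNIV. f i u) - (\<Sum>i\<in>UNIV. f i c) - (real CARD('n) * L * (1 + R) + \<delta> * L) * spread x
      - \<delta> * L * (1 + P * V)
    \<le> (\<Sum>i\<in>UNIV. \<eta> i * (g i \<bullet> (v i - c)))"
proof -
  let ?e = "spread x"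
  have "f i u - f i c - L * ((1 + R) * ?e) - \<bar>\<eta> i - 1\<bar> * (L * (?e + (1 + P * V))) \<le> \<eta> i * (g i \<bullet> (v i - c))" for i
  proof -
    \<comment> \<open>Bounding \<open>f i (v i)\<close> below by \<open>f i u\<close> needs an
      affine minorant anchored at \<open>u\<close>, not at \<open>v i\<close>.\<close>
    obtain h where h: "h \<in> subdifferential (f i) u" using subgradient_exists[OF conv] by blast
    have "norm (v i - u) \<le> norm (v i - x k) + norm (x k - u)" by norm
    with u(2) v(2)[of i k] have vu: "norm (v i - u) \<le> (1 + R) * ?e" by (simp add: distrib_right)
    have "\<bar>h \<bullet> (v i - u)\<bar> \<le> norm h * norm (v i - u)" by (rule Cauchy_Schwarz_ineq2)
    also have "\<dots> \<le> L * ((1 + R) * ?e)" using L(2)[OF u(1) h] vu L(1) by (intro mult_mono) auto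
    finally have 1: "f i u - L * ((1 + R) * ?e) \<le> f i (v i)"
      using h by (auto simp: subdifferential_def abs_le_iff dest!: spec[of _ "v i"])
    have 2: "f i (v i) - f i c \<le> g i \<bullet> (v i - c)"
      using g[of i] by (auto simp: subdifferential_def inner_diff_right dest!: spec[of _ c])
    \<comment> \<open>Trading the distance for its square makes the error affine in
      \<open>V\<close>, as the Robbins-Siegmund recursion requires.\<close>
    have "norm (x i - c) \<le> 1 + (norm (x i - c))\<^sup>2"
    proof -
      have "0 \<le> (norm (x i - c) - 1)\<^sup>2 + (norm (x i - c))\<^sup>2 + 1" by simp
      then show ?thesis by (simp add: power2_diff)
    qed
    moreover have "(norm (x i - c))\<^sup>2 \<le> P * V"
    proof -
      have "p i * (norm (x i - c))\<^sup>2 \<le> V"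
        unfolding V by (rule member_le_sum[of i UNIV "\<lambda>i. p i * (norm (x i - c))\<^sup>2"]) (auto simp: less_imp_le[OF p_pos])
      moreover have "1 / p i \<le> P"
        unfolding P by (rule member_le_sum[of i UNIV "\<lambda>i. 1 / p i"]) (auto simp: less_imp_le[OF p_pos])
      moreover have "0 \<le> V"
        unfolding V by (auto intro!: sum_nonneg mult_nonneg_nonneg simp: less_imp_le[OF p_pos])
      ultimately have "(1 / p i) * (p i * (norm (x i - c))\<^sup>2) \<le> P * V"
        using p_pos by (intro mult_mono) (auto simp: less_imp_le order_trans[OF _ \<open>1 / p i \<le> P\<close>])
      then show ?thesis using p_pos[of i] by simp
    qed
    moreover have "norm (v i - c) \<le> norm (v i - x i) + norm (x i - c)" by norm
    ultimately have vc: "norm (v i - c) \<le> ?e + (1 + P * V)" using v(2)[of i i] by linarith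
    have "\<bar>(\<eta> i - 1) * (g i \<bullet> (v i - c))\<bar> \<le> \<bar>\<eta> i - 1\<bar> * (norm (g i) * norm (v i - c))"
      unfolding abs_mult by (intro mult_left_mono Cauchy_Schwarz_ineq2) auto
    also have "\<dots> \<le> \<bar>\<eta> i - 1\<bar> * (L * (?e + (1 + P * V)))"
      using L(2)[OF v(1) g] vc L(1) by (intro mult_left_mono mult_mono) auto
    finally have 3: "\<bar>(\<eta> i - 1) * (g i \<bullet> (v i - c))\<bar> \<le> \<bar>\<eta> i - 1\<bar> * (L * (?e + (1 + P * V)))" .
    have "\<eta> i * (g i \<bullet> (v i - c)) = g i \<bullet> (v i - c) + (\<eta> i - 1) * (g i \<bullet> (v i - c))"
      by (simp add: algebra_simps)
    with 1 2 3 show ?thesis by linarith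
  qed
  then have "(\<Sum>i\<in>UNIV. f i u - f i c - L * ((1 + R) * ?e) - \<bar>\<eta> i - 1\<bar> * (L * (?e + (1 + P * V))))
      \<le> (\<Sum>i\<in>UNIV. \<eta> i * (g i \<bullet> (v i - c)))"
    by (intro sum_mono)
  then show ?thesis
    unfolding sum_subtractf sum_distrib_right[symmetric] \<delta>[symmetric]
    by (simp add: algebra_simps)
qed

text \<open>Common core of both algorithms. Subgradients are taken at \<open>v t i\<close>, which is
  the average in Algorithm 1 and the iterate in Algorithm 2; \<open>\<eta> t i\<close> stands for
  the ratio of \<open>p i\<close> to the diagonal entry of \<open>z\<close>. The update rule enters
  through \<open>xX\<close>, \<open>v\<close>, \<open>g\<close> and \<open>descent\<close>.\<close>

lemma subgradient_iteration_converges: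
  fixes f :: "'n \<Rightarrow> 'a::euclidean_space \<Rightarrow> real" and x v g :: "nat \<Rightarrow> 'n \<Rightarrow> 'a"
  assumes conv: "\<And>i. convex_on UNIV (f i)"
    and X: "\<And>i. closed (X i)" "\<And>i. convex (X i)" "\<And>i. X i \<subseteq> U"
    and opt: "optimal_set f X \<noteq> {}"
    and R: "0 \<le> R" "\<And>y. y \<in> U \<Longrightarrow> infdist y (\<Inter>i. X i) \<le> R * (MAX i. infdist y (X i))"
    and L: "0 < L" "\<And>i y h. y \<in> U \<Longrightarrow> h \<in> subdifferential (f i) y \<Longrightarrow> norm h \<le> L"
    and \<alpha>: "\<And>t. 0 < \<alpha> t" "decseq \<alpha>" "\<not> summable \<alpha>" "summable (\<lambda>t. (\<alpha> t)\<^sup>2)"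
    and \<eta>: "\<And>i. summable (\<lambda>t. \<bar>\<eta> t i - 1\<bar>)"
    and xX: "\<And>t i. x t i \<in> X i"
    and v: "\<And>t i. v t i \<in> U" "\<And>t i j. norm (v t i - x t j) \<le> spread (x t)"
    and g: "\<And>t i. g t i \<in> subdifferential (f i) (v t i)"
    and \<kappa>: "0 < \<kappa>" and C: "0 \<le> C"
    and descent: "\<And>t c. c \<in> (\<Inter>i. X i) \<Longrightarrow>
      (\<Sum>i\<in>UNIV. p i * (norm (x (Suc t) i - c))\<^sup>2)
        \<le> (\<Sum>i\<in>UNIV. p i * (norm (x t i - c))\<^sup>2) - \<kappa> * (spread (x t))\<^sup>2 + C * (\<alpha> t)\<^sup>2
          - 2 * \<alpha> t * (\<Sum>i\<in>UNIV. \<eta> t i * (g t i \<bullet> (v t i - c)))"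
  shows "\<exists>xstar\<in>optimal_set f X. \<forall>i. (\<lambda>t. x t i) \<longlonglongrightarrow> xstar"
proof -
  define Y where "Y = (\<Inter>i. X i)"
  define F where "F y = (\<Sum>i\<in>UNIV. f i y)" for y
  define V where "V c t = (\<Sum>i\<in>UNIV. p i * (norm (x t i - c))\<^sup>2)" for c t
  define e where "e t = spread (x t)" for t
  define \<delta> where "\<delta> t = (\<Sum>i\<in>UNIV. \<bar>\<eta> t i - 1\<bar>)" for t
  define P where "P = (\<Sum>i\<in>UNIV. 1 / p i)"
  \<comment> \<open>An arbitrary reference agent; the others differ from it by at most the
    spread.\<close>
  define k :: 'n where "k = undefined"
  \<comment> \<open>Measuring the objective at a feasible point makes its gap to the minimum
    nonnegative, which need not hold at the iterates.\<close>
  define u where "u t = closest_point Y (x t k)" for t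
  obtain c0 where "c0 \<in> optimal_set f X" using opt by blast
  then have c0: "c0 \<in> Y" "\<And>y. y \<in> Y \<Longrightarrow> F c0 \<le> F y"
    by (auto simp: optimal_set_def is_arg_min_def Y_def F_def not_less)
  have optI: "c \<in> optimal_set f X" if "c \<in> Y" "F c \<le> F c0" for c
    using that c0 by (force simp: optimal_set_def is_arg_min_def Y_def F_def not_less)
  have Y: "closed Y" "convex Y" "Y \<noteq> {}"
    using X c0 by (auto simp: Y_def intro!: closed_INT convex_INT)
  have YU: "Y \<subseteq> U" using X(3) by (auto simp: Y_def)
  have uY: "u t \<in> Y" for t unfolding u_def by (rule closest_point_in_set[OF Y(1,3)])
  have xu: "norm (x t k - u t) \<le> R * e t" for t
  proof -
    have "norm (x t k - u t) = infdist (x t k) Y"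
      using Y by (simp add: u_def dist_norm infdist_eq_setdist setdist_closest_point)
    also have "\<dots> \<le> R * (MAX i. infdist (x t k) (X i))"
      unfolding Y_def by (rule R(2)) (use xX X(3) in blast)
    also have "\<dots> \<le> R * e t"
      unfolding e_def by (intro mult_left_mono R(1) Max_infdist_le_spread xX)
    finally show ?thesis .
  qed
  have \<delta>0: "0 \<le> \<delta> t" for t unfolding \<delta>_def by (intro sum_nonneg) auto
  have s\<delta>: "summable \<delta>" unfolding \<delta>_def by (intro summable_sum \<eta>)
  define H where "H = suminf \<delta>"
  have \<delta>H: "\<delta> t \<le> H" for t
    using sum_le_suminf[OF s\<delta>, of "{t}"] \<delta>0 by (simp add: H_def)
  have e0: "0 \<le> e t" for t by (simp add: e_def spread_nonneg)
  have V0: "0 \<le> V c t" for c t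
    unfolding V_def by (auto intro!: sum_nonneg mult_nonneg_nonneg simp: less_imp_le[OF p_pos])
  have P0: "0 \<le> P" unfolding P_def by (auto intro!: sum_nonneg simp: less_imp_le[OF p_pos])
  have \<alpha>0: "\<alpha> t \<le> \<alpha> 0" for t using \<alpha>(2) by (simp add: decseqD)
  \<comment> \<open>Bookkeeping for the recursion: \<open>G\<close> bounds the coefficient of the
    spread uniformly in time through \<open>\<delta> t \<le> H\<close>; \<open>a\<close> and
    \<open>b\<close> split the scaling error into its parts proportional to and independent of
    \<open>V\<close>, with \<open>\<alpha> t\<close> replaced by \<open>\<alpha> 0\<close>;
    \<open>b\<close> also takes the terms of order \<open>\<alpha>\<close> squared; \<open>q\<close>
    keeps half of the quadratic decrease and the objective gap.\<close>
  define G where "G = real CARD('n) * L * (1 + R) + H * L"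
  define a where "a t = 2 * \<alpha> 0 * L * P * \<delta> t" for t
  define b where "b t = (C + 2 * G\<^sup>2 / \<kappa>) * (\<alpha> t)\<^sup>2 + 2 * \<alpha> 0 * L * \<delta> t" for t
  define q where "q c t = \<kappa> / 2 * (e t)\<^sup>2 + 2 * (\<alpha> t * (F (u t) - F c))" for c t
  have step: "V c (Suc t) \<le> (1 + a t) * V c t + b t - q c t" if c: "c \<in> Y" for c t
  proof -
    have "F (u t) - F c - (real CARD('n) * L * (1 + R) + \<delta> t * L) * e t - \<delta> t * L * (1 + P * V c t)
        \<le> (\<Sum>i\<in>UNIV. \<eta> t i * (g t i \<bullet> (v t i - c)))"
      unfolding F_def e_def
      by (rule subgradient_iteration_step[OF conv L subsetD[OF YU uY] xu[unfolded e_def] v g P_def V_def \<delta>_def])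
    moreover have "(real CARD('n) * L * (1 + R) + \<delta> t * L) * e t \<le> G * e t"
      unfolding G_def using \<delta>H L(1) e0 by (intro mult_right_mono add_left_mono) auto
    ultimately have "F (u t) - F c - G * e t - \<delta> t * L * (1 + P * V c t)
        \<le> (\<Sum>i\<in>UNIV. \<eta> t i * (g t i \<bullet> (v t i - c)))" by linarith
    then have "2 * \<alpha> t * (F (u t) - F c - G * e t - \<delta> t * L * (1 + P * V c t))
        \<le> 2 * \<alpha> t * (\<Sum>i\<in>UNIV. \<eta> t i * (g t i \<bullet> (v t i - c)))"
      using \<alpha>(1)[of t] by (intro mult_left_mono) auto
    moreover have "2 * \<alpha> t * (\<delta> t * L * (1 + P * V c t)) \<le> 2 * \<alpha> 0 * (\<delta> t * L * (1 + P * V c t))"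
      using \<alpha>0[of t] \<delta>0 L(1) P0 V0 by (intro mult_right_mono mult_nonneg_nonneg add_nonneg_nonneg) auto
    moreover note am_gm_absorb[OF \<kappa>, of "\<alpha> t" G "e t"]
    moreover have "V c (Suc t) \<le> V c t - \<kappa> * (e t)\<^sup>2 + C * (\<alpha> t)\<^sup>2
        - 2 * \<alpha> t * (\<Sum>i\<in>UNIV. \<eta> t i * (g t i \<bullet> (v t i - c)))"
      unfolding V_def e_def by (rule descent[OF c[unfolded Y_def]])
    ultimately show ?thesis by (simp add: a_def b_def q_def algebra_simps)
  qed
  have a0: "0 \<le> a t" for t using \<alpha>(1)[of 0] L(1) P0 \<delta>0[of t] by (simp add: a_def)
  have b0: "0 \<le> b t" for t using \<alpha>(1)[of 0] L(1) \<delta>0[of t] C \<kappa> by (simp add: b_def)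
  have sa: "summable a" unfolding a_def by (intro summable_mult s\<delta>)
  have sb: "summable b" unfolding b_def by (intro summable_add summable_mult s\<delta> \<alpha>(4))
  \<comment> \<open>Optimality of \<open>c\<close> makes \<open>q c\<close> nonnegative. The claim
    is kept general in \<open>c\<close> since it is used for \<open>c0\<close> first and later for
    the limit point.\<close>
  have main: "convergent (V c)" "summable (q c)" if c: "c \<in> Y" "F c \<le> F c0" for c
  proof -
    have q0: "0 \<le> q c t" for t
      using \<kappa> \<alpha>(1)[of t] c0(2)[OF uY[of t]] c(2) by (simp add: q_def less_imp_le)
    show "convergent (V c)" "summable (q c)"
      by (rule robbins_siegmund[of "V c" a b "q c", OF V0 a0 b0 q0 step[OF c(1)] sa sb])+
  qed
  \<comment> \<open>Both summands of \<open>q c0\<close> are nonnegative, so each is summable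
    separately.\<close>
  have parts: "0 \<le> \<kappa> / 2 * (e t)\<^sup>2" "0 \<le> 2 * (\<alpha> t * (F (u t) - F c0))" for t
    using \<kappa> \<alpha>(1)[of t] c0(2)[OF uY[of t]] by (auto simp: less_imp_le)
  have "summable (\<lambda>t. \<kappa> / 2 * (e t)\<^sup>2)"
    by (rule summable_comparison_test'[OF main(2)[OF c0(1)], where N=0]) (use parts in \<open>auto simp: q_def\<close>)
  then have "summable (\<lambda>t. (e t)\<^sup>2)" using \<kappa> by (simp add: summable_cmult_iff)
  then have e_lim: "e \<longlonglongrightarrow> 0"
    using tendsto_real_sqrt[OF summable_LIMSEQ_zero] e0 by fastforce
  have "summable (\<lambda>t. 2 * (\<alpha> t * (F (u t) - F c0)))"
    by (rule summable_comparison_test'[OF main(2)[OF c0(1)], where N=0]) (use parts in \<open>auto simp: q_def\<close>)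
  then have "summable (\<lambda>t. \<alpha> t * (F (u t) - F c0))" by (simp add: summable_cmult_iff)
  then have "\<exists>t\<ge>N. F (u t) - F c0 < inverse (real (Suc n))" for N n
    using \<alpha> by (intro frequently_small_of_summable_product) auto
  then obtain r where r: "strict_mono r" "\<And>n. F (u (r n)) - F c0 < inverse (real (Suc n))"
    using strict_mono_selection[of "\<lambda>n t. F (u t) - F c0 < inverse (real (Suc n))"] by blast
  \<comment> \<open>\<open>V c0\<close> bounds the reference agent, and the bounded spread keeps
    \<open>u\<close> near it.\<close>
  have "bounded (range u)"
  proof -
    obtain B where B: "\<And>t. V c0 t \<le> B"
      using convergent_imp_Bseq[OF main(1)[OF c0(1)]] by (force simp: Bseq_def abs_le_iff)
    obtain D where D: "\<And>t. e t \<le> D"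
      using convergent_imp_Bseq[of e] e_lim by (force simp: Bseq_def abs_le_iff convergent_def)
    have "norm (u t) \<le> norm c0 + sqrt (B / p k) + R * D" for t
    proof -
      have "p k * (norm (x t k - c0))\<^sup>2 \<le> V c0 t"
        unfolding V_def by (rule member_le_sum[of k UNIV "\<lambda>i. p i * (norm (x t i - c0))\<^sup>2"]) (auto simp: less_imp_le[OF p_pos])
      with B[of t] have "p k * (norm (x t k - c0))\<^sup>2 \<le> B" by linarith
      then have "norm (x t k - c0) \<le> sqrt (B / p k)"
        using p_pos[of k] by (intro real_le_rsqrt) (simp add: field_simps)
      moreover have "norm (x t k - u t) \<le> R * D"
        using xu[of t] mult_left_mono[OF D R(1), of t] by linarith
      moreover have "norm (u t) \<le> norm c0 + norm (x t k - c0) + norm (x t k - u t)" by norm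
      ultimately show ?thesis by linarith
    qed
    then show ?thesis by (auto simp: bounded_iff)
  qed
  then have "bounded (range (u \<circ> r))" by (rule bounded_subset) auto
  then obtain c s where s: "strict_mono s" and lim: "((u \<circ> r) \<circ> s) \<longlonglongrightarrow> c"
    using bounded_imp_convergent_subsequence by blast
  have cY: "c \<in> Y" by (rule closed_sequentially[OF Y(1) _ lim]) (auto simp: uY)
  have "continuous_on UNIV F"
    unfolding F_def by (intro continuous_on_sum convex_on_continuous conv) auto
  then have "(\<lambda>n. F (((u \<circ> r) \<circ> s) n)) \<longlonglongrightarrow> F c"
    by (rule continuous_on_tendsto_compose[OF _ lim]) auto
  moreover have "(\<lambda>n. F c0 + inverse (real (Suc (s n)))) \<longlonglongrightarrow> F c0 + 0"
    using LIMSEQ_subseq_LIMSEQ[OF LIMSEQ_inverse_real_of_nat s]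
    by (intro tendsto_intros) (simp add: o_def)
  \<comment> \<open>Continuity of \<open>F\<close> carries the vanishing gap to the limit point, so
    \<open>c\<close> is a minimizer and \<open>main\<close> applies to it.\<close>
  ultimately have Fc: "F c \<le> F c0"
  proof -
    assume *: "(\<lambda>n. F (((u \<circ> r) \<circ> s) n)) \<longlonglongrightarrow> F c"
      "(\<lambda>n. F c0 + inverse (real (Suc (s n)))) \<longlonglongrightarrow> F c0 + 0"
    have "F c \<le> F c0 + 0"
      by (rule LIMSEQ_le[OF *]) (use r(2) in \<open>auto intro!: exI[of _ 0] simp: less_imp_le diff_less_eq add.commute\<close>)
    then show ?thesis by simp
  qed
  let ?m = "r \<circ> s"
  have m: "strict_mono ?m" using r(1) s by (rule strict_mono_o)
  have "(\<lambda>n. (1 + R) * e (?m n) + norm (u (?m n) - c)) \<longlonglongrightarrow> (1 + R) * 0 + norm (c - c)"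
    using LIMSEQ_subseq_LIMSEQ[OF e_lim m] lim by (intro tendsto_intros) (auto simp: o_def)
  then have *: "(\<lambda>n. (1 + R) * e (?m n) + norm (u (?m n) - c)) \<longlonglongrightarrow> 0" by simp
  have "(\<lambda>n. x (?m n) i - c) \<longlonglongrightarrow> 0" for i
  proof (rule Lim_null_comparison[OF _ *], intro always_eventually allI)
    fix n
    let ?t = "?m n"
    have "norm (x ?t i - c) \<le> norm (x ?t i - x ?t k) + norm (x ?t k - u ?t) + norm (u ?t - c)" by norm
    then show "norm (x ?t i - c) \<le> (1 + R) * e ?t + norm (u ?t - c)"
      using norm_diff_le_spread[of "x ?t" i k] xu[of ?t] by (simp add: e_def distrib_right)
  qed
  then have "(\<lambda>n. V c (?m n)) \<longlonglongrightarrow> (\<Sum>i\<in>UNIV. p i * (norm (0::'a))\<^sup>2)"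
    unfolding V_def by (intro tendsto_intros)
  moreover obtain l where l: "V c \<longlonglongrightarrow> l" using main(1)[OF cY Fc] by (auto simp: convergent_def)
  moreover have "(\<lambda>n. V c (?m n)) \<longlonglongrightarrow> l" using LIMSEQ_subseq_LIMSEQ[OF l m] by (simp add: o_def)
  \<comment> \<open>The whole sequence \<open>V c\<close> converges, so its limit is the one along
    the subsequence.\<close>
  ultimately have V_lim: "V c \<longlonglongrightarrow> 0" using LIMSEQ_unique by fastforce
  have "(\<lambda>t. x t i) \<longlonglongrightarrow> c" for i
  proof (rule LIM_zero_cancel, rule Lim_null_comparison)
    show "(\<lambda>t. sqrt (V c t / p i)) \<longlonglongrightarrow> 0"
      using tendsto_real_sqrt[OF tendsto_divide[OF V_lim tendsto_const[of "p i"]]] p_pos[of i] by simp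
    show "\<forall>\<^sub>F t in sequentially. norm (x t i - c) \<le> sqrt (V c t / p i)"
    proof (intro always_eventually allI)
      fix t
      have "p i * (norm (x t i - c))\<^sup>2 \<le> V c t"
        unfolding V_def by (rule member_le_sum[of i UNIV "\<lambda>i. p i * (norm (x t i - c))\<^sup>2"]) (auto simp: less_imp_le[OF p_pos])
      then show "norm (x t i - c) \<le> sqrt (V c t / p i)"
        using p_pos[of i] by (intro real_le_rsqrt) (simp add: field_simps)
    qed
  qed
  with optI[OF cY Fc] show ?thesis by blast
qed

end

section \<open>Descent for gradient steps and projections\<close>

lemma norm_closest_point_le:
  fixes c :: "'a::euclidean_space"
  assumes "closed S" "convex S" "c \<in> S"
  shows "norm (closest_point S y - c) \<le> norm (y - c)"
  using closest_point_lipschitz[of S y c] assms by (auto simp: closest_point_self dist_norm)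

lemma power2_norm_gradient_step:
  fixes y g c :: "'a::real_inner"
  shows "(norm (y - \<beta> *\<^sub>R g - c))\<^sup>2 = (norm (y - c))\<^sup>2 - 2 * \<beta> * (g \<bullet> (y - c)) + \<beta>\<^sup>2 * (norm g)\<^sup>2"
  unfolding power2_norm_eq_inner
  by (simp add: inner_diff_left inner_diff_right inner_commute algebra_simps power2_eq_square)

context stationary_weights
begin

text \<open>Weighting by \<open>p i\<close> a step of length \<open>a / z i\<close> produces the
  factor \<open>p i / z i\<close>, which is close to 1 for the \<open>z\<close>-iteration; the
  quadratic terms sum up through the normalization of \<open>p\<close>.\<close>

lemma weighted_gradient_step:
  fixes y g :: "'n \<Rightarrow> 'a::real_inner"
  assumes "\<And>i. norm (g i) \<le> L" "\<And>i. 0 < z i" "\<And>i. 1 / z i \<le> K"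
  shows "(\<Sum>i\<in>UNIV. p i * (norm (y i - (a / z i) *\<^sub>R g i - c))\<^sup>2)
    \<le> (\<Sum>i\<in>UNIV. p i * (norm (y i - c))\<^sup>2)
      - 2 * a * (\<Sum>i\<in>UNIV. p i / z i * (g i \<bullet> (y i - c))) + K\<^sup>2 * L\<^sup>2 * a\<^sup>2"
proof -
  have "p i * (norm (y i - (a / z i) *\<^sub>R g i - c))\<^sup>2 \<le> p i * (norm (y i - c))\<^sup>2
      - 2 * a * (p i / z i * (g i \<bullet> (y i - c))) + p i * (K\<^sup>2 * L\<^sup>2 * a\<^sup>2)" for i
  proof -
    have "(a / z i)\<^sup>2 * (norm (g i))\<^sup>2 = (1 / z i)\<^sup>2 * (norm (g i))\<^sup>2 * a\<^sup>2"
      by (simp add: power_divide)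
    also have "\<dots> \<le> K\<^sup>2 * L\<^sup>2 * a\<^sup>2"
      using assms(2)[of i] by (intro mult_right_mono mult_mono power_mono assms) auto
    finally have "p i * ((a / z i)\<^sup>2 * (norm (g i))\<^sup>2) \<le> p i * (K\<^sup>2 * L\<^sup>2 * a\<^sup>2)"
      using p_pos[of i] by (intro mult_left_mono) auto
    then show ?thesis unfolding power2_norm_gradient_step by (simp add: algebra_simps)
  qed
  then have "(\<Sum>i\<in>UNIV. p i * (norm (y i - (a / z i) *\<^sub>R g i - c))\<^sup>2)
      \<le> (\<Sum>i\<in>UNIV. p i * (norm (y i - c))\<^sup>2
      - 2 * a * (p i / z i * (g i \<bullet> (y i - c))) + p i * (K\<^sup>2 * L\<^sup>2 * a\<^sup>2))"
    by (intro sum_mono)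
  also have "\<dots> = (\<Sum>i\<in>UNIV. p i * (norm (y i - c))\<^sup>2)
      - 2 * a * (\<Sum>i\<in>UNIV. p i / z i * (g i \<bullet> (y i - c))) + (\<Sum>i\<in>UNIV. p i) * (K\<^sup>2 * L\<^sup>2 * a\<^sup>2)"
    unfolding sum.distrib sum_subtractf sum_distrib_left sum_distrib_right ..
  finally show ?thesis by (simp add: p_sum)
qed

text \<open>The agents project onto different sets, but each of these projections is nonexpansive
  and fixes the common point \<open>c\<close>.\<close>

lemma projected_descent:
  fixes y g :: "'n \<Rightarrow> 'a::euclidean_space"
  assumes "\<And>i. closed (X i)" "\<And>i. convex (X i)" "c \<in> (\<Inter>i. X i)"
  shows "(\<Sum>i\<in>UNIV. p i * (norm (closest_point (X i) (y i) - c))\<^sup>2) \<le> (\<Sum>i\<in>UNIV. p i * (norm (y i - c))\<^sup>2)"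
  using assms by (intro sum_mono mult_left_mono power_mono norm_closest_point_le) (auto simp: less_imp_le[OF p_pos])

end

section \<open>The two algorithms\<close>

locale consensus_problem = stationary_weights "\<lambda>i j. W $ i $ j" p
  for W :: "real^'n::finite^'n" and p +
  fixes f :: "'n \<Rightarrow> real^'m::finite \<Rightarrow> real" and X :: "'n \<Rightarrow> (real^'m) set"
    and U :: "(real^'m) set" and R L :: real and \<alpha> :: "nat \<Rightarrow> real"
  assumes f_convex: "convex_on UNIV (f i)"
    and X_closed: "closed (X i)" and X_convex: "convex (X i)" and X_ne: "(\<Inter>i. X i) \<noteq> {}"
    and opt_ne: "optimal_set f X \<noteq> {}"
    and X_U: "X i \<subseteq> U" and U_convex: "convex U"
    and R_nonneg: "0 \<le> R" and regular: "y \<in> U \<Longrightarrow> infdist y (\<Inter>i. X i) \<le> R * (MAX i. infdist y (X i))"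
    and L_pos: "0 < L" and sub_bound: "y \<in> U \<Longrightarrow> h \<in> subdifferential (f i) y \<Longrightarrow> norm h \<le> L"
    and \<alpha>_pos: "0 < \<alpha> t" and \<alpha>_decseq: "decseq \<alpha>"
    and \<alpha>_not_summable: "\<not> summable \<alpha>" and \<alpha>_square_summable: "summable (\<lambda>t. (\<alpha> t)\<^sup>2)"
begin

lemma shifted_steps:
  "0 < \<alpha> (Suc t)" "decseq (\<lambda>t. \<alpha> (Suc t))" "\<not> summable (\<lambda>t. \<alpha> (Suc t))" "summable (\<lambda>t. (\<alpha> (Suc t))\<^sup>2)"
  using \<alpha>_pos \<alpha>_decseq \<alpha>_not_summable \<alpha>_square_summable
  by (auto simp: decseq_Suc_iff summable_Suc_iff summable_Suc_iff[of "\<lambda>t. (\<alpha> t)\<^sup>2"])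

lemma average_in_U:
  assumes "\<And>j. x j \<in> U"
  shows "(\<Sum>j\<in>UNIV. W $ i $ j *\<^sub>R x j) \<in> U"
  by (rule convex_sum) (auto simp: U_convex w_nonneg row_sum assms)

lemma closest_point_X: "closest_point (X i) y \<in> X i"
  using X_ne by (intro closest_point_in_set X_closed) auto

text \<open>The initial points are arbitrary and may lie outside \<open>U\<close>, where nothing bounds the
  subgradients; both convergence proofs therefore start at time 1.\<close>

lemma alg1_converges:
  assumes "generated_by_alg1 W f X \<alpha> x"
  shows "\<exists>xstar\<in>optimal_set f X. \<forall>i. (\<lambda>t. x t i) \<longlonglongrightarrow> xstar"
proof -
  define y where "y t i = (\<Sum>j\<in>UNIV. W $ i $ j *\<^sub>R x t j)" for t i
  obtain g where g: "\<And>t i. g t i \<in> subdifferential (f i) (y t i)"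
    and x: "\<And>t i. x (Suc t) i = closest_point (X i) (y t i - (\<alpha> t / z_seq W t i $ i) *\<^sub>R g t i)"
    using assms unfolding generated_by_alg1_def y_def by blast
  have xX: "x (Suc t) i \<in> X i" for t i unfolding x by (rule closest_point_X)
  have yU: "y (Suc t) i \<in> U" for t i unfolding y_def using xX X_U by (intro average_in_U) blast
  obtain K where K: "0 < K" "\<And>t i. 0 < z_seq W t i $ i" "\<And>t i. 1 / z_seq W t i $ i \<le> K"
    and \<eta>: "\<And>i. summable (\<lambda>t. \<bar>p i / z_seq W t i $ i - 1\<bar>)"
    using z_seq_scaling[OF stationary_weights_axioms] by blast
  obtain \<kappa> where \<kappa>: "0 < \<kappa>" and contr: "\<And>(x :: 'n \<Rightarrow> real^'m) c.
      (\<Sum>i\<in>UNIV. p i * (norm ((\<Sum>j\<in>UNIV. W $ i $ j *\<^sub>R x j) - c))\<^sup>2)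
        \<le> (\<Sum>i\<in>UNIV. p i * (norm (x i - c))\<^sup>2) - \<kappa> * (spread x)\<^sup>2"
    using averaging_contraction[where 'a="real^'m"] by blast
  have "\<exists>xstar\<in>optimal_set f X. \<forall>i. (\<lambda>t. x (Suc t) i) \<longlonglongrightarrow> xstar"
  proof (rule subgradient_iteration_converges[where x="\<lambda>t. x (Suc t)" and v="\<lambda>t. y (Suc t)"
        and g="\<lambda>t. g (Suc t)" and \<alpha>="\<lambda>t. \<alpha> (Suc t)" and \<eta>="\<lambda>t i. p i / z_seq W (Suc t) i $ i"
        and C="K\<^sup>2 * L\<^sup>2", OF f_convex X_closed X_convex X_U opt_ne R_nonneg regular L_pos sub_bound
        shifted_steps _ xX yU _ g \<kappa>])
    show "summable (\<lambda>t. \<bar>p i / z_seq W (Suc t) i $ i - 1\<bar>)" for i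
      by (subst summable_Suc_iff) (rule \<eta>)
    show "norm (y (Suc t) i - x (Suc t) j) \<le> spread (x (Suc t))" for t i j
      unfolding y_def by (intro average_near_points w_nonneg row_sum)
    show "0 \<le> K\<^sup>2 * L\<^sup>2" by simp
    fix t c assume c: "c \<in> (\<Inter>i. X i)"
    let ?t = "Suc t"
    have "(\<Sum>i\<in>UNIV. p i * (norm (x (Suc ?t) i - c))\<^sup>2)
        \<le> (\<Sum>i\<in>UNIV. p i * (norm (y ?t i - (\<alpha> ?t / z_seq W ?t i $ i) *\<^sub>R g ?t i - c))\<^sup>2)"
      unfolding x by (rule projected_descent[OF X_closed X_convex c])
    also have "\<dots> \<le> (\<Sum>i\<in>UNIV. p i * (norm (y ?t i - c))\<^sup>2)
        - 2 * \<alpha> ?t * (\<Sum>i\<in>UNIV. p i / z_seq W ?t i $ i * (g ?t i \<bullet> (y ?t i - c))) + K\<^sup>2 * L\<^sup>2 * (\<alpha> ?t)\<^sup>2"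
      by (rule weighted_gradient_step[OF sub_bound[OF yU g] K(2,3)])
    \<comment> \<open>Averaging comes before the gradient step, so the contraction already yields
      the spread of the iterates.\<close>
    also have "(\<Sum>i\<in>UNIV. p i * (norm (y ?t i - c))\<^sup>2)
        \<le> (\<Sum>i\<in>UNIV. p i * (norm (x ?t i - c))\<^sup>2) - \<kappa> * (spread (x ?t))\<^sup>2"
      unfolding y_def by (rule contr)
    finally show "(\<Sum>i\<in>UNIV. p i * (norm (x (Suc ?t) i - c))\<^sup>2)
        \<le> (\<Sum>i\<in>UNIV. p i * (norm (x ?t i - c))\<^sup>2) - \<kappa> * (spread (x ?t))\<^sup>2 + K\<^sup>2 * L\<^sup>2 * (\<alpha> ?t)\<^sup>2
          - 2 * \<alpha> ?t * (\<Sum>i\<in>UNIV. p i / z_seq W ?t i $ i * (g ?t i \<bullet> (y ?t i - c)))"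
      by simp
  qed
  then show ?thesis using LIMSEQ_imp_Suc[where f="\<lambda>t. x t i" for i] by blast
qed

text \<open>Here the gradient step precedes averaging, so the contraction yields the spread of the
  shifted points \<open>q\<close>. Since \<open>q\<close> differs from the iterates by order
  \<open>\<alpha>\<close>, the spread of the iterates is recovered at half the constant
  \<open>\<kappa>\<close> plus an error of order \<open>\<alpha>\<close> squared.\<close>

lemma alg2_converges:
  assumes "generated_by_alg2 W f X \<alpha> x"
  shows "\<exists>xstar\<in>optimal_set f X. \<forall>i. (\<lambda>t. x t i) \<longlonglongrightarrow> xstar"
proof -
  obtain g where g: "\<And>t i. g t i \<in> subdifferential (f i) (x t i)"
    and x: "\<And>t i. x (Suc t) i = closest_point (X i)
          (\<Sum>j\<in>UNIV. W $ i $ j *\<^sub>R (x t j - (\<alpha> t / z_seq W t j $ j) *\<^sub>R g t j))"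
    using assms unfolding generated_by_alg2_def by blast
  define q where "q t j = x t j - (\<alpha> t / z_seq W t j $ j) *\<^sub>R g t j" for t j
  have xX: "x (Suc t) i \<in> X i" for t i unfolding x by (rule closest_point_X)
  then have xU: "x (Suc t) i \<in> U" for t i using X_U by blast
  obtain K where K: "0 < K" "\<And>t i. 0 < z_seq W t i $ i" "\<And>t i. 1 / z_seq W t i $ i \<le> K"
    and \<eta>: "\<And>i. summable (\<lambda>t. \<bar>p i / z_seq W t i $ i - 1\<bar>)"
    using z_seq_scaling[OF stationary_weights_axioms] by blast
  obtain \<kappa> where \<kappa>: "0 < \<kappa>" and contr: "\<And>(x :: 'n \<Rightarrow> real^'m) c.
      (\<Sum>i\<in>UNIV. p i * (norm ((\<Sum>j\<in>UNIV. W $ i $ j *\<^sub>R x j) - c))\<^sup>2)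
        \<le> (\<Sum>i\<in>UNIV. p i * (norm (x i - c))\<^sup>2) - \<kappa> * (spread x)\<^sup>2"
    using averaging_contraction[where 'a="real^'m"] by blast
  \<comment> \<open>The constant of \<open>spread_perturb\<close> for a shift of size
    \<open>\<alpha> t * (K * L)\<close>, with the factor \<open>\<alpha> t\<close> taken
    out.\<close>
  define B where "B = real CARD('n) * (real CARD('n) * (2 * (K * L)))"
  have spread_q: "\<kappa> / 2 * (spread (x (Suc t)))\<^sup>2 \<le> \<kappa> * (spread (q (Suc t)))\<^sup>2 + \<kappa> * B\<^sup>2 * (\<alpha> (Suc t))\<^sup>2" for t
  proof -
    let ?t = "Suc t"
    have "norm (x ?t i - q ?t i) \<le> \<alpha> ?t * (K * L)" for i
    proof -
      have "norm (x ?t i - q ?t i) = \<alpha> ?t * (1 / z_seq W ?t i $ i * norm (g ?t i))"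
        using \<alpha>_pos[of ?t] K(2)[of ?t i] by (simp add: q_def)
      also have "\<dots> \<le> \<alpha> ?t * (K * L)"
        using less_imp_le[OF \<alpha>_pos] less_imp_le[OF K(1)]
        by (intro mult_left_mono mult_mono K(3) sub_bound[OF xU g]) auto
      finally show ?thesis .
    qed
    from spread_perturb[OF this] have "spread (x ?t) \<le> spread (q ?t) + B * \<alpha> ?t"
      by (simp add: B_def algebra_simps)
    then have "(spread (x ?t))\<^sup>2 \<le> (spread (q ?t) + B * \<alpha> ?t)\<^sup>2" by (intro power_mono spread_nonneg)
    \<comment> \<open>The factor 2 arising here is the reason for passing from
      \<open>\<kappa>\<close> to \<open>\<kappa> / 2\<close>.\<close>
    also have "\<dots> \<le> 2 * (spread (q ?t))\<^sup>2 + 2 * (B * \<alpha> ?t)\<^sup>2"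
      using sum_squares_bound[of "spread (q ?t)" "B * \<alpha> ?t"] by (simp add: power2_sum)
    finally have "\<kappa> / 2 * (spread (x ?t))\<^sup>2 \<le> \<kappa> / 2 * (2 * (spread (q ?t))\<^sup>2 + 2 * (B * \<alpha> ?t)\<^sup>2)"
      using \<kappa> by (intro mult_left_mono) auto
    then show ?thesis by (simp add: algebra_simps power_mult_distrib)
  qed
  have "\<exists>xstar\<in>optimal_set f X. \<forall>i. (\<lambda>t. x (Suc t) i) \<longlonglongrightarrow> xstar"
  proof (rule subgradient_iteration_converges[where x="\<lambda>t. x (Suc t)" and v="\<lambda>t. x (Suc t)"
        and g="\<lambda>t. g (Suc t)" and \<alpha>="\<lambda>t. \<alpha> (Suc t)" and \<eta>="\<lambda>t i. p i / z_seq W (Suc t) i $ i"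
        and C="K\<^sup>2 * L\<^sup>2 + \<kappa> * B\<^sup>2" and \<kappa>="\<kappa> / 2",
        OF f_convex X_closed X_convex X_U opt_ne R_nonneg regular L_pos sub_bound
        shifted_steps _ xX xU norm_diff_le_spread g])
    show "summable (\<lambda>t. \<bar>p i / z_seq W (Suc t) i $ i - 1\<bar>)" for i
      by (subst summable_Suc_iff) (rule \<eta>)
    show "0 < \<kappa> / 2" "0 \<le> K\<^sup>2 * L\<^sup>2 + \<kappa> * B\<^sup>2" using \<kappa> by auto
    fix t c assume c: "c \<in> (\<Inter>i. X i)"
    let ?t = "Suc t"
    have "(\<Sum>i\<in>UNIV. p i * (norm (x (Suc ?t) i - c))\<^sup>2)
        \<le> (\<Sum>i\<in>UNIV. p i * (norm ((\<Sum>j\<in>UNIV. W $ i $ j *\<^sub>R q ?t j) - c))\<^sup>2)"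
      unfolding x q_def by (rule projected_descent[OF X_closed X_convex c])
    also have "\<dots> \<le> (\<Sum>i\<in>UNIV. p i * (norm (q ?t i - c))\<^sup>2) - \<kappa> * (spread (q ?t))\<^sup>2"
      by (rule contr)
    also have "(\<Sum>i\<in>UNIV. p i * (norm (q ?t i - c))\<^sup>2) \<le> (\<Sum>i\<in>UNIV. p i * (norm (x ?t i - c))\<^sup>2)
        - 2 * \<alpha> ?t * (\<Sum>i\<in>UNIV. p i / z_seq W ?t i $ i * (g ?t i \<bullet> (x ?t i - c))) + K\<^sup>2 * L\<^sup>2 * (\<alpha> ?t)\<^sup>2"
      unfolding q_def by (rule weighted_gradient_step[OF sub_bound[OF xU g] K(2,3)])
    finally show "(\<Sum>i\<in>UNIV. p i * (norm (x (Suc ?t) i - c))\<^sup>2)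
        \<le> (\<Sum>i\<in>UNIV. p i * (norm (x ?t i - c))\<^sup>2) - \<kappa> / 2 * (spread (x ?t))\<^sup>2
          + (K\<^sup>2 * L\<^sup>2 + \<kappa> * B\<^sup>2) * (\<alpha> ?t)\<^sup>2
          - 2 * \<alpha> ?t * (\<Sum>i\<in>UNIV. p i / z_seq W ?t i $ i * (g ?t i \<bullet> (x ?t i - c)))"
      using spread_q[of t] by (simp add: distrib_right)
  qed
  then show ?thesis using LIMSEQ_imp_Suc[where f="\<lambda>t. x t i" for i] by blast
qed

end

section \<open>From the graph to the convergence theorem\<close>

lemma strongly_connected_imp_rtrancl:
  assumes "strongly_connected (with_proj \<lparr>pverts = UNIV, parcs = E\<rparr>)"
  shows "(i, j) \<in> E\<^sup>*"
  using assms reachable_rtranclI[where G="with_proj \<lparr>pverts = UNIV, parcs = E\<rparr>" and u=i and v=j]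
  by (auto simp: strongly_connected_def)

theorem theorem4:
  fixes E :: "('n::finite \<times> 'n) set"
    and W :: "real^'n^'n"
    and f :: "'n \<Rightarrow> real^'m::finite \<Rightarrow> real"
    and X :: "'n \<Rightarrow> (real^'m) set"
    and U :: "(real^'m) set"
    and \<alpha> :: "nat \<Rightarrow> real"
  assumes "strongly_connected (with_proj \<lparr>pverts = UNIV, parcs = E\<rparr>)"
    and "weight_matrix E W"
    and "\<And>i. convex_on UNIV (f i)"
    and "\<And>i. closed (X i)"
    and "\<And>i. convex (X i)"
    and "(\<Inter>i. X i) \<noteq> {}"
    and "optimal_set f X \<noteq> {}"
    and "U = convex hull (\<Union>i. X i)"
    and "set_regular X U"
    and "bounded_subgradients f U"
    and "\<And>t. 0 < \<alpha> t"
    and "decseq \<alpha>"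
    and "filterlim (\<lambda>T. \<Sum>t<T. \<alpha> t) at_top sequentially"
    and "summable (\<lambda>t. (\<alpha> t)\<^sup>2)"
  shows "(\<forall>x. generated_by_alg1 W f X \<alpha> x \<longrightarrow>
            (\<exists>xstar\<in>optimal_set f X. \<forall>i. (\<lambda>t. x t i) \<longlonglongrightarrow> xstar)) \<and>
         (\<forall>x. generated_by_alg2 W f X \<alpha> x \<longrightarrow>
            (\<exists>xstar\<in>optimal_set f X. \<forall>i. (\<lambda>t. x t i) \<longlonglongrightarrow> xstar))"
proof -
  have W: "\<And>i j. 0 \<le> W $ i $ j" "\<And>i. 0 < W $ i $ i" "\<And>i j. (i, j) \<in> E \<Longrightarrow> 0 < W $ i $ j"
    and W1: "W *v 1 = 1"
    using assms(2) by (auto simp: weight_matrix_def)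
  have row: "(\<Sum>j\<in>UNIV. W $ i $ j) = 1" for i
    using arg_cong[OF W1, of "\<lambda>u. u $ i"] by (simp add: matrix_vector_mult_def)
  \<comment> \<open>Paths in the graph are paths along positive weights, so strong connectivity
    gives irreducibility.\<close>
  have "E \<subseteq> {(i, j). 0 < W $ i $ j}" using W(3) by auto
  then have irr: "(i, j) \<in> {(i, j). 0 < W $ i $ j}\<^sup>*" for i j
    using strongly_connected_imp_rtrancl[OF assms(1), of i j] rtrancl_mono by blast
  obtain p where p: "stationary_weights (\<lambda>i j. W $ i $ j) p"
    using stationary_weights_exist[of "\<lambda>i j. W $ i $ j", OF W(1) row W(2) irr] by blast
  obtain R where R: "1 \<le> R" "\<And>y. y \<in> U \<Longrightarrow> infdist y (\<Inter>i. X i) \<le> R * (MAX i. infdist y (X i))"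
    using assms(9) by (auto simp: set_regular_def)
  obtain L where L: "0 < L" "\<And>i y h. y \<in> U \<Longrightarrow> h \<in> subdifferential (f i) y \<Longrightarrow> norm h \<le> L"
    using assms(10) by (auto simp: bounded_subgradients_def)
  have XU: "X i \<subseteq> U" for i
    unfolding assms(8) using hull_subset[of "\<Union>i. X i" convex] by blast
  have div: "\<not> summable \<alpha>"
  proof
    assume "summable \<alpha>"
    then have "(\<lambda>T. \<Sum>t<T. \<alpha> t) \<longlonglongrightarrow> suminf \<alpha>" by (rule summable_LIMSEQ)
    then show False
      using not_tendsto_and_filterlim_at_infinity[OF sequentially_bot] filterlim_at_top_imp_at_infinity[OF assms(13)]
      by blast
  qed
  interpret stationary_weights "\<lambda>i j. W $ i $ j" p by (rule p)
  interpret consensus_problem W p f X U R L \<alpha>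
    using assms(3-7,11,12,14) R L XU div by unfold_locales (auto simp: assms(8))
  show ?thesis using alg1_converges alg2_converges by blast
qed

end
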